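(* Let $q\in\mathbb{C}$ with $|q|=1$, let $n\ge2$ and $r\in(0,+\infty)$. Then the Fréchet algebras $\mathcal{O}_q(\mathbb{D}_r^n)$ and $\mathcal{O}_q(\mathbb{B}_r^n)$ are not topologically isomorphic (there is no bijective algebra homomorphism between them that is continuous with continuous inverse).
   Context: $\mathcal{O}_q^{\mathrm{reg}}(\mathbb{C}^n)$: algebra generated by $x_1,\dots,x_n$ with $x_ix_j=qx_jx_i$ ($i<j$); basis $x^k=x_1^{k_1}\cdots x_n^{k_n}$, $k\in\mathbb{Z}_+^n$. For $|q|=1$ and $f=\sum_kc_kx^k$: $\|f\|_{\mathbb{D},\rho}=\sum_k|c_k|\rho^{|k|}$ and $\|f\|_{\mathbb{B},\rho}=\sum_k|c_k|\big(k!/|k|!\big)^{1/2}\rho^{|k|}$, where $|k|=\sum k_i$, $k!=\prod k_i!$. $\mathcal{O}_q(\mathbb{D}_r^n)$ (resp. $\mathcal{O}_q(\mathbb{B}_r^n)$) is the completion of $\mathcal{O}_q^{\mathrm{reg}}(\mathbb{C}^n)$ with respect to the submultiplicative norms $\|\cdot\|_{\mathbb{D},\rho}$ (resp. $\|\cdot\|_{\mathbb{B},\rho}$), $\rho\in(0,r)$; concretely, the Fréchet algebra of formal series $\sum_kc_kx^k$ with all these norms finite, with multiplication extending that of $\mathcal{O}_q^{\mathrm{reg}}(\mathbb{C}^n)$. *)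

theory Defs
  imports "HOL-Analysis.Analysis"
begin

text \<open>Multi-indices k in Z_+^n, represented as functions nat => nat vanishing from n on.
  A formal series sum_k c_k x^k is represented by its coefficient function
  (nat => nat) => complex, which vanishes outside the multi-indices.\<close>

definition MI :: "nat \<Rightarrow> (nat \<Rightarrow> nat) set" where
  "MI n = {k. \<forall>i\<ge>n. k i = 0}"

definition deg :: "nat \<Rightarrow> (nat \<Rightarrow> nat) \<Rightarrow> nat" where
  "deg n k = (\<Sum>i<n. k i)"

definition wD :: "nat \<Rightarrow> real \<Rightarrow> (nat \<Rightarrow> nat) \<Rightarrow> real" where
  "wD n \<rho> k = \<rho> ^ deg n k"

definition wB :: "nat \<Rightarrow> real \<Rightarrow> (nat \<Rightarrow> nat) \<Rightarrow> real" where
  "wB n \<rho> k = sqrt ((\<Prod>i<n. fact (k i)) / fact (deg n k)) * \<rho> ^ deg n k"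

definition wnorm :: "nat \<Rightarrow> ((nat \<Rightarrow> nat) \<Rightarrow> real) \<Rightarrow> ((nat \<Rightarrow> nat) \<Rightarrow> complex) \<Rightarrow> real" where
  "wnorm n w f = (\<Sum>\<^sub>\<infinity>k\<in>MI n. norm (f k) * w k)"

definition PS :: "nat \<Rightarrow> (real \<Rightarrow> (nat \<Rightarrow> nat) \<Rightarrow> real) \<Rightarrow> real \<Rightarrow> ((nat \<Rightarrow> nat) \<Rightarrow> complex) set" where
  "PS n w r = {f. (\<forall>k. k \<notin> MI n \<longrightarrow> f k = 0) \<and>
                  (\<forall>\<rho>\<in>{0<..<r}. (\<lambda>k. norm (f k) * w \<rho> k) summable_on MI n)}"

definition OqD :: "nat \<Rightarrow> real \<Rightarrow> ((nat \<Rightarrow> nat) \<Rightarrow> complex) set" where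
  "OqD n r = PS n (wD n) r"

definition OqB :: "nat \<Rightarrow> real \<Rightarrow> ((nat \<Rightarrow> nat) \<Rightarrow> complex) set" where
  "OqB n r = PS n (wB n) r"

text \<open>Quantum multiplication: x^k x^l = q^(- sum_{i>j} k_i l_j) x^(k+l), extended
  to formal series (each coefficient of the product is a finite sum).\<close>

definition qmul :: "complex \<Rightarrow> nat \<Rightarrow> ((nat \<Rightarrow> nat) \<Rightarrow> complex) \<Rightarrow> ((nat \<Rightarrow> nat) \<Rightarrow> complex)
                     \<Rightarrow> ((nat \<Rightarrow> nat) \<Rightarrow> complex)" where
  "qmul q n f g = (\<lambda>m. if m \<in> MI n then
      (\<Sum>k\<in>{k \<in> MI n. \<forall>i. k i \<le> m i}.
          f k * g (\<lambda>i. m i - k i) * (inverse q) ^ (\<Sum>i<n. \<Sum>j<i. k i * (m j - k j)))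
    else 0)"

definition sn_top :: "((nat \<Rightarrow> nat) \<Rightarrow> complex) set \<Rightarrow> (real \<Rightarrow> ((nat \<Rightarrow> nat) \<Rightarrow> complex) \<Rightarrow> real)
                       \<Rightarrow> real \<Rightarrow> ((nat \<Rightarrow> nat) \<Rightarrow> complex) topology" where
  "sn_top A N r = topology (\<lambda>U. U \<subseteq> A \<and>
     (\<forall>f\<in>U. \<exists>F \<epsilon>. finite F \<and> F \<subseteq> {0<..<r} \<and> \<epsilon> > 0 \<and>
        {g \<in> A. \<forall>\<rho>\<in>F. N \<rho> (\<lambda>k. g k - f k) < \<epsilon>} \<subseteq> U))"

definition topD :: "nat \<Rightarrow> real \<Rightarrow> ((nat \<Rightarrow> nat) \<Rightarrow> complex) topology" where
  "topD n r = sn_top (OqD n r) (\<lambda>\<rho>. wnorm n (wD n \<rho>)) r"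

definition topB :: "nat \<Rightarrow> real \<Rightarrow> ((nat \<Rightarrow> nat) \<Rightarrow> complex) topology" where
  "topB n r = sn_top (OqB n r) (\<lambda>\<rho>. wnorm n (wB n \<rho>)) r"

end

theory Submission
  imports Defs "HOL-Complex_Analysis.Complex_Analysis" "HOL-Real_Asymp.Real_Asymp"
begin

text \<open>A bounded functional on either algebra is determined by its values on monomials, so a topological
  isomorphism \<open>\<phi>\<close> with inverse \<open>\<psi>\<close> can be probed by characters and point derivations.

  If \<open>q \<noteq> 1\<close>, comparing coefficients in the commutation relations of the \<open>\<phi> (x\<^sub>i)\<close> shows that \<open>\<phi>\<close>
  preserves the augmentation and acts on linear parts by a monomial matrix.  Comparing the growth of
  \<open>\<phi> (x\<^sub>i\<^sup>m)\<close> with that of \<open>x\<^sub>i\<^sup>m\<close> bounds the matrix entries by 1, so the leading coefficient of the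
  image of \<open>x\<^sub>1\<^sup>m x\<^sub>2\<^sup>m\<close> under \<open>\<psi>\<close> has modulus at least 1.  This is incompatible with the factor
  \<open>(m! m! / (2m)!)\<^bsup>1/2\<^esup> \<le> 2\<^bsup>-m/2\<^esup>\<close> in the ball norm of \<open>x\<^sub>1\<^sup>m x\<^sub>2\<^sup>m\<close>.

  If \<open>q = 1\<close>, the elements \<open>\<phi> (x\<^sub>i)\<close> and \<open>\<psi> (x\<^sub>i)\<close> are the coordinates of mutually inverse holomorphic
  maps \<open>G : B \<rightarrow> D\<close> and \<open>F : D \<rightarrow> B\<close> between ball and polydisc.  Take two analytic discs in \<open>D\<close> through
  \<open>G 0\<close> whose velocities there have two nonzero coordinates, each of the maximal length allowed by
  Schwarz-Pick, and differ by the sign of the second one.  Their images under \<open>F\<close> have velocities of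
  norm at most \<open>r\<close> by Cauchy's inequality, while half the sum and half the difference of these have
  norm at least \<open>r\<close> by Schwarz-Pick for the coordinates of \<open>G\<close>, contradicting the parallelogram law.\<close>

section \<open>Multi-indices and monomials\<close>

definition unit_idx :: "nat \<Rightarrow> nat \<Rightarrow> nat" where
  "unit_idx i = (\<lambda>j. if j = i then 1 else 0)"

definition mon :: "(nat \<Rightarrow> nat) \<Rightarrow> (nat \<Rightarrow> nat) \<Rightarrow> complex" where
  "mon k = (\<lambda>j. if j = k then 1 else 0)"

abbreviation zidx :: "nat \<Rightarrow> nat" where "zidx \<equiv> (\<lambda>_. 0)"
abbreviation addi :: "(nat \<Rightarrow> nat) \<Rightarrow> (nat \<Rightarrow> nat) \<Rightarrow> nat \<Rightarrow> nat" where
  "addi k l \<equiv> (\<lambda>i. k i + l i)"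
abbreviation gen :: "nat \<Rightarrow> (nat \<Rightarrow> nat) \<Rightarrow> complex" where "gen i \<equiv> mon (unit_idx i)"

definition le_idx :: "nat \<Rightarrow> (nat \<Rightarrow> nat) \<Rightarrow> (nat \<Rightarrow> nat) set" where
  "le_idx n m = {k \<in> MI n. \<forall>i. k i \<le> m i}"

text \<open>The number of transpositions that bring x^k x^l to normal order: each x_i of the left
  factor passes each x_j with j < i of the right one, at the cost of one factor q^-1.\<close>

definition qexp :: "nat \<Rightarrow> (nat \<Rightarrow> nat) \<Rightarrow> (nat \<Rightarrow> nat) \<Rightarrow> nat" where
  "qexp n k l = (\<Sum>i<n. \<Sum>j<i. k i * l j)"

lemma zidx_MI [simp]: "zidx \<in> MI n" by (simp add: MI_def)
lemma unit_idx_MI [simp]: "i < n \<Longrightarrow> unit_idx i \<in> MI n" by (simp add: MI_def unit_idx_def)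
lemma addi_MI [simp]: "k \<in> MI n \<Longrightarrow> l \<in> MI n \<Longrightarrow> addi k l \<in> MI n" by (simp add: MI_def)
lemma diff_MI [simp]: "k \<in> MI n \<Longrightarrow> (\<lambda>i. k i - l i) \<in> MI n" by (simp add: MI_def)

lemma unit_idx_inj [simp]: "unit_idx i = unit_idx j \<longleftrightarrow> i = j"
  by (auto simp: unit_idx_def fun_eq_iff split: if_splits)

lemma unit_idx_not_zero [simp]: "unit_idx i \<noteq> zidx" "zidx \<noteq> unit_idx i"
  by (auto simp: unit_idx_def fun_eq_iff)

lemma mon_coeffs [simp]:
  "mon k k = 1" "gen i zidx = 0" "mon zidx (unit_idx i) = 0"
  "gen i (unit_idx j) = (if j = i then 1 else 0)"
  by (simp_all add: mon_def)

lemma deg_add [simp]: "deg n (addi k l) = deg n k + deg n l"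
  by (simp add: deg_def sum.distrib)

lemma deg_zidx [simp]: "deg n zidx = 0" by (simp add: deg_def)

lemma deg_unit_idx [simp]: "i < n \<Longrightarrow> deg n (unit_idx i) = 1"
  by (simp add: deg_def unit_idx_def)

lemma deg_eq_0: "k \<in> MI n \<Longrightarrow> deg n k = 0 \<longleftrightarrow> k = zidx"
  by (auto simp: deg_def MI_def fun_eq_iff) (meson lessThan_iff not_le)

lemma deg_pos_decompose:
  assumes "k \<in> MI n" "deg n k = Suc N"
  obtains i l where "i < n" "l \<in> MI n" "deg n l = N" "k = addi (unit_idx i) l"
proof -
  have "k \<noteq> zidx" using assms by auto
  then obtain i where i: "k i \<noteq> 0" by (auto simp: fun_eq_iff)
  have "i < n"
  proof (rule ccontr)
    assume "\<not> i < n"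
    then show False using assms(1) i by (simp add: MI_def)
  qed
  define l where "l = (\<lambda>j. k j - unit_idx i j)"
  have kl: "k = addi (unit_idx i) l" using i by (auto simp: l_def unit_idx_def fun_eq_iff)
  have "deg n k = deg n (unit_idx i) + deg n l" by (subst kl) simp
  then have "deg n l = N" using assms(2) \<open>i < n\<close> by simp
  moreover have "l \<in> MI n" using assms(1) by (simp add: l_def)
  ultimately show ?thesis using that kl \<open>i < n\<close> by blast
qed

text \<open>Peeling off one unit index lowers the degree by one. The step adds
  \<open>unit_idx i\<close> on the left so as to match left multiplication by a generator.\<close>

lemma MI_induct [consumes 1, case_names zero step]:
  assumes "k \<in> MI n" "P zidx"
    and "\<And>i k. i < n \<Longrightarrow> k \<in> MI n \<Longrightarrow> P k \<Longrightarrow> P (addi (unit_idx i) k)"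
  shows "P k"
  using assms(1)
proof (induction "deg n k" arbitrary: k)
  case 0
  then have "k = zidx" using deg_eq_0[of k n] by simp
  then show ?case using assms(2) by simp
next
  case (Suc N)
  obtain i l where il: "i < n" "l \<in> MI n" "deg n l = N" "k = addi (unit_idx i) l"
    using deg_pos_decompose[OF Suc(3) Suc(2)[symmetric]] by blast
  have "P l" using Suc(1)[of l] il by simp
  then show ?case unfolding il(4) using il by (intro assms(3))
qed

lemma deg_1:
  assumes "k \<in> MI n" "deg n k = 1" shows "\<exists>i<n. k = unit_idx i"
proof -
  obtain i l where "i < n" "l \<in> MI n" "deg n l = 0" "k = addi (unit_idx i) l"
    using deg_pos_decompose[of k n 0] assms by (metis One_nat_def)
  moreover from this have "l = zidx" using deg_eq_0[of l n] by simp
  ultimately show ?thesis by auto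
qed

text \<open>Multi-indices vanish from n on, so restriction to the first n places is injective. What
  matters later is that the bound is polynomial in \<open>N\<close>.\<close>

lemma finite_bounded_MI: "finite {k \<in> MI n. \<forall>i. k i \<le> N}"
  and card_bounded_MI: "card {k \<in> MI n. \<forall>i. k i \<le> N} \<le> (N + 1) ^ n"
proof -
  let ?A = "{k \<in> MI n. \<forall>i. k i \<le> N}"
  let ?B = "{..<n} \<rightarrow>\<^sub>E {..N}"
  have inj: "inj_on (\<lambda>k. restrict k {..<n}) ?A"
  proof (rule inj_onI)
    fix k l assume kl: "k \<in> ?A" "l \<in> ?A" "restrict k {..<n} = restrict l {..<n}"
    show "k = l"
    proof
      fix i show "k i = l i"
        using kl by (cases "i < n") (auto simp: MI_def not_less dest!: fun_cong[of _ _ i])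
    qed
  qed
  have sub: "(\<lambda>k. restrict k {..<n}) ` ?A \<subseteq> ?B"
    by (intro image_subsetI, subst restrict_PiE_iff) auto
  have fin: "finite ?B" by (auto intro!: finite_PiE)
  show "finite ?A" by (rule finite_imageD[OF finite_subset[OF sub fin] inj])
  have "card ?A \<le> card ?B" by (rule card_inj_on_le[OF inj sub fin])
  then show "card ?A \<le> (N + 1) ^ n" by (simp add: card_PiE)
qed

lemma deg_level_subset: "{k \<in> MI n. deg n k = N} \<subseteq> {k \<in> MI n. \<forall>i. k i \<le> N}"
proof clarify
  fix k i assume k: "k \<in> MI n" "N = deg n k"
  show "k i \<le> deg n k"
  proof (cases "i < n")
    case True
    then show ?thesis unfolding deg_def by (intro member_le_sum) auto
  qed (use k in \<open>auto simp: MI_def\<close>)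
qed

lemma finite_deg_level [simp]: "finite {k \<in> MI n. deg n k = N}"
  by (rule finite_subset[OF deg_level_subset finite_bounded_MI])

lemma card_deg_level: "card {k \<in> MI n. deg n k = N} \<le> (N + 1) ^ n"
  using card_mono[OF finite_bounded_MI deg_level_subset] card_bounded_MI le_trans by blast

lemma finite_le_idx [simp]:
  assumes "m \<in> MI n" shows "finite (le_idx n m)"
proof (rule finite_subset[OF _ finite_bounded_MI])
  show "le_idx n m \<subseteq> {k \<in> MI n. \<forall>i. k i \<le> deg n m}"
    using subsetD[OF deg_level_subset[of n "deg n m"], of m] assms
    by (auto simp: le_idx_def intro: order_trans)
qed

section \<open>The twisted product and lowest-order terms\<close>

lemma qmul_altdef:
  "qmul q n f g m = (if m \<in> MI n then
     (\<Sum>k\<in>le_idx n m. f k * g (\<lambda>i. m i - k i) * (inverse q) ^ qexp n k (\<lambda>i. m i - k i)) else 0)"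
  by (simp add: qmul_def le_idx_def qexp_def)

text \<open>The lowest-order part of \<open>f\<close> is v x^K in the strong sense that no other
  monomial of degree at most |K| occurs; \<open>v\<close> may be 0.\<close>

definition lead :: "nat \<Rightarrow> ((nat \<Rightarrow> nat) \<Rightarrow> complex) \<Rightarrow> (nat \<Rightarrow> nat) \<Rightarrow> complex \<Rightarrow> bool" where
  "lead n f K v \<longleftrightarrow> K \<in> MI n \<and> (\<forall>k\<in>MI n. deg n k \<le> deg n K \<longrightarrow> f k = (if k = K then v else 0))"

lemma le_idx_add: "k \<in> le_idx n m \<Longrightarrow> addi k (\<lambda>i. m i - k i) = m"
  by (auto simp: le_idx_def fun_eq_iff)

lemma qmul_single:
  assumes "m \<in> MI n" "K \<in> MI n" "L \<in> MI n"
    and "\<And>k. k \<in> le_idx n m \<Longrightarrow>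
      f k * g (\<lambda>i. m i - k i) = (if k = K \<and> (\<lambda>i. m i - k i) = L then v else 0)"
  shows "qmul q n f g m = (if m = addi K L then v * (inverse q) ^ qexp n K L else 0)"
proof -
  have "qmul q n f g m = (\<Sum>k\<in>le_idx n m.
      if k = K \<and> (\<lambda>i. m i - k i) = L then v * (inverse q) ^ qexp n K L else 0)"
    unfolding qmul_altdef using assms by (auto intro!: sum.cong)
  also have "\<dots> = (\<Sum>k\<in>le_idx n m. if k = K then if m = addi K L then v * (inverse q) ^ qexp n K L else 0 else 0)"
  proof (rule sum.cong[OF refl])
    fix k assume k: "k \<in> le_idx n m"
    have "(\<lambda>i. m i - k i) = L \<longleftrightarrow> m = addi k L"
      using le_idx_add[OF k] by (metis (no_types, lifting) add_diff_cancel_left' ext)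
    then show "(if k = K \<and> (\<lambda>i. m i - k i) = L then v * (inverse q) ^ qexp n K L else 0) =
      (if k = K then if m = addi K L then v * (inverse q) ^ qexp n K L else 0 else 0)"
      by auto
  qed
  also have "\<dots> = (if m = addi K L then v * (inverse q) ^ qexp n K L else 0)"
    using assms by (auto simp: le_idx_def finite_le_idx[unfolded le_idx_def])
  finally show ?thesis .
qed

text \<open>If k + l = m and |m| <= |K| + |L|, then either one of the degrees lies below that of
  \<open>K\<close> or \<open>L\<close>, where the coefficients vanish, or both agree with them and
  only k = K, l = L survives.\<close>

lemma lead_qmul:
  assumes "lead n f K v" "lead n g L u"
  shows "lead n (qmul q n f g) (addi K L) (v * u * (inverse q) ^ qexp n K L)"
  unfolding lead_def
proof (intro conjI ballI impI)
  show "addi K L \<in> MI n" using assms by (simp add: lead_def)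
next
  fix m assume m: "m \<in> MI n" "deg n m \<le> deg n (addi K L)"
  show "qmul q n f g m = (if m = addi K L then v * u * (inverse q) ^ qexp n K L else 0)"
  proof (rule qmul_single)
    fix k assume k: "k \<in> le_idx n m"
    let ?l = "\<lambda>i. m i - k i"
    have kl: "k \<in> MI n" "?l \<in> MI n" "deg n k + deg n ?l = deg n m"
      using k m deg_add[of n k ?l] le_idx_add[OF k] by (auto simp: le_idx_def)
    have f: "deg n k \<le> deg n K \<Longrightarrow> f k = (if k = K then v else 0)"
      using assms kl by (auto simp: lead_def)
    have g: "deg n ?l \<le> deg n L \<Longrightarrow> g ?l = (if ?l = L then u else 0)"
      using assms(2) kl(2) unfolding lead_def by blast
    consider "deg n k < deg n K" | "deg n k = deg n K" | "deg n k > deg n K" by linarith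
    then show "f k * g ?l = (if k = K \<and> ?l = L then v * u else 0)"
    proof cases
      case 1
      then have "k \<noteq> K" by auto
      then show ?thesis using f 1 by simp
    next
      case 2
      then show ?thesis using f g kl m by simp
    next
      case 3
      then have lt: "deg n ?l < deg n L" using kl m by simp
      then have "?l \<noteq> L" by auto
      then show ?thesis using g lt by simp
    qed
  qed (use m assms in \<open>auto simp: lead_def\<close>)
qed

lemma qmul_mon:
  assumes "k \<in> MI n" "l \<in> MI n"
  shows "qmul q n (mon k) (mon l) = (\<lambda>m. (inverse q) ^ qexp n k l * mon (addi k l) m)"
proof
  fix m
  show "qmul q n (mon k) (mon l) m = (inverse q) ^ qexp n k l * mon (addi k l) m"
  proof (cases "m \<in> MI n")
    case True
    show ?thesis
      using qmul_single[OF True assms, of "mon k" "mon l" 1 q] by (auto simp: mon_def)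
  next
    case False
    then have "m \<noteq> addi k l" using assms by auto
    then show ?thesis using False by (simp add: qmul_altdef mon_def)
  qed
qed

lemma lead_mon: "K \<in> MI n \<Longrightarrow> lead n (mon K) K 1"
  by (simp add: lead_def mon_def)

lemma qmul_supp: "m \<notin> MI n \<Longrightarrow> qmul q n f g m = 0"
  by (simp add: qmul_altdef)

lemma qexp_zero [simp]: "qexp n zidx l = 0" "qexp n k zidx = 0"
  by (simp_all add: qexp_def)

lemma qmul_one_left:
  assumes "\<And>k. k \<notin> MI n \<Longrightarrow> f k = 0" shows "qmul q n (mon zidx) f = f"
proof
  fix m show "qmul q n (mon zidx) f m = f m"
  proof (cases "m \<in> MI n")
    case True
    then have z: "zidx \<in> le_idx n m" by (simp add: le_idx_def)
    have "qmul q n (mon zidx) f m = (\<Sum>k\<in>le_idx n m. if k = zidx then f m else 0)"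
      unfolding qmul_altdef if_P[OF True] by (rule sum.cong) (auto simp: mon_def)
    then show ?thesis using z True by simp
  qed (use assms in \<open>simp add: qmul_supp\<close>)
qed

lemma qmul_one_right:
  assumes "\<And>k. k \<notin> MI n \<Longrightarrow> f k = 0" shows "qmul q n f (mon zidx) = f"
proof
  fix m show "qmul q n f (mon zidx) m = f m"
  proof (cases "m \<in> MI n")
    case True
    then have z: "m \<in> le_idx n m" by (simp add: le_idx_def)
    have eq: "(\<lambda>i. m i - k i) = zidx \<longleftrightarrow> k = m" if "k \<in> le_idx n m" for k
      using le_idx_add[OF that] by (auto simp: fun_eq_iff)
    have "qmul q n f (mon zidx) m = (\<Sum>k\<in>le_idx n m. if k = m then f m else 0)"
      unfolding qmul_altdef if_P[OF True] by (rule sum.cong) (auto simp: mon_def eq)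
    then show ?thesis using z True by simp
  qed (use assms in \<open>simp add: qmul_supp\<close>)
qed

lemma le_idx_zero: "le_idx n zidx = {zidx}"
  by (auto simp: le_idx_def)

lemma le_idx_unit: "i < n \<Longrightarrow> le_idx n (unit_idx i) = {zidx, unit_idx i}"
proof (intro equalityI subsetI)
  fix k assume "k \<in> le_idx n (unit_idx i)" "i < n"
  then have k: "\<And>j. k j \<le> (if j = i then 1 else 0)" by (auto simp: le_idx_def unit_idx_def)
  show "k \<in> {zidx, unit_idx i}"
  proof (cases "k i = 0")
    case True
    then have "k j = 0" for j using k[of j] by (auto split: if_splits)
    then show ?thesis by auto
  next
    case False
    then have "k j = unit_idx i j" for j using k[of j] by (auto simp: unit_idx_def split: if_splits)
    then show ?thesis by auto
  qed
qed (auto simp: le_idx_def unit_idx_def MI_def)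

lemma qmul_zero_coeff: "qmul q n f g zidx = f zidx * g zidx"
  by (simp add: qmul_altdef le_idx_zero)

lemma qmul_unit_coeff:
  assumes "i < n"
  shows "qmul q n f g (unit_idx i) = f zidx * g (unit_idx i) + f (unit_idx i) * g zidx"
  using assms by (simp add: qmul_altdef le_idx_unit)

lemma qexp_unit_same [simp]: "qexp n (unit_idx i) (unit_idx i) = 0"
  unfolding qexp_def by (intro sum.neutral ballI) (simp add: unit_idx_def)

text \<open>The index 2 e_i splits only as 0 + 2 e_i, e_i + e_i and 2 e_i + 0. The outer splittings
  die with the constant terms and the middle one carries no power of q, so at x_i^2 the linear parts
  multiply as if they commuted.\<close>

lemma qmul_square_coeff:
  assumes "i < n" "f zidx = 0" "g zidx = 0"
  shows "qmul q n f g (addi (unit_idx i) (unit_idx i)) = f (unit_idx i) * g (unit_idx i)"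
proof -
  let ?m = "addi (unit_idx i) (unit_idx i)"
  have "f k * g (\<lambda>j. ?m j - k j) =
     (if k = unit_idx i \<and> (\<lambda>j. ?m j - k j) = unit_idx i then f (unit_idx i) * g (unit_idx i) else 0)"
    if k: "k \<in> le_idx n ?m" for k
  proof (cases "k = unit_idx i")
    case True
    then show ?thesis by simp
  next
    case False
    have le: "k j \<le> (if j = i then 2 else 0)" for j
    proof -
      have "k j \<le> unit_idx i j + unit_idx i j" using k by (auto simp: le_idx_def)
      then show ?thesis by (auto simp: unit_idx_def)
    qed
    have z: "k j = 0" if "j \<noteq> i" for j using le[of j] that by simp
    have "k i \<noteq> 1"
    proof
      assume "k i = 1"
      then have "k j = unit_idx i j" for j using z[of j] by (simp add: unit_idx_def)
      then show False using False by (metis ext)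
    qed
    then consider "k i = 0" | "k i = 2" using le[of i] by fastforce
    then show ?thesis
    proof cases
      case 1
      then have "k = zidx" using z by (metis ext)
      then show ?thesis using assms by simp
    next
      case 2
      then have "(\<lambda>j. ?m j - k j) = zidx" using z by (auto simp: fun_eq_iff unit_idx_def)
      then show ?thesis using assms False by simp
    qed
  qed
  then have "qmul q n f g ?m = (if ?m = addi (unit_idx i) (unit_idx i)
      then f (unit_idx i) * g (unit_idx i) * (inverse q) ^ qexp n (unit_idx i) (unit_idx i) else 0)"
    using assms(1) by (intro qmul_single) auto
  then show ?thesis by simp
qed

section \<open>Weighted power series spaces\<close>

type_synonym series = "(nat \<Rightarrow> nat) \<Rightarrow> complex"

text \<open>What the two families of norms have in common, so that both directions of an isomorphism
  are covered by the same lemmas.\<close>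

locale weight =
  fixes n :: nat and w :: "real \<Rightarrow> (nat \<Rightarrow> nat) \<Rightarrow> real" and r :: real
  assumes r_pos: "0 < r"
    and w_pos: "\<lbrakk>0 < \<rho>; \<rho> < r; k \<in> MI n\<rbrakk> \<Longrightarrow> 0 < w \<rho> k"
    and w_mono: "\<lbrakk>0 < \<rho>; \<rho> \<le> \<sigma>; \<sigma> < r; k \<in> MI n\<rbrakk> \<Longrightarrow> w \<rho> k \<le> w \<sigma> k"
begin

abbreviation A :: "series set" where "A \<equiv> PS n w r"
abbreviation N :: "real \<Rightarrow> series \<Rightarrow> real" where "N \<rho> \<equiv> wnorm n (w \<rho>)"

lemma A_supp: "f \<in> A \<Longrightarrow> k \<notin> MI n \<Longrightarrow> f k = 0"
  by (simp add: PS_def)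

lemma A_summable: "f \<in> A \<Longrightarrow> 0 < \<rho> \<Longrightarrow> \<rho> < r \<Longrightarrow> (\<lambda>k. norm (f k) * w \<rho> k) summable_on MI n"
  by (simp add: PS_def)

lemma AI:
  assumes "\<And>k. k \<notin> MI n \<Longrightarrow> f k = 0"
    and "\<And>\<rho>. 0 < \<rho> \<Longrightarrow> \<rho> < r \<Longrightarrow> (\<lambda>k. norm (f k) * w \<rho> k) summable_on MI n"
  shows "f \<in> A"
  using assms by (simp add: PS_def)

lemma A_add:
  assumes "f \<in> A" "g \<in> A" shows "(\<lambda>k. f k + g k) \<in> A"
proof (rule AI)
  fix \<rho> assume \<rho>: "0 < \<rho>" "\<rho> < r"
  have "(\<lambda>k. norm (f k) * w \<rho> k + norm (g k) * w \<rho> k) summable_on MI n"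
    using assms \<rho> by (intro summable_on_add A_summable)
  then show "(\<lambda>k. norm (f k + g k) * w \<rho> k) summable_on MI n"
  proof (rule summable_on_comparison_test)
    fix k assume "k \<in> MI n"
    then show "norm (f k + g k) * w \<rho> k \<le> norm (f k) * w \<rho> k + norm (g k) * w \<rho> k"
      "0 \<le> norm (f k + g k) * w \<rho> k"
      using w_pos[of \<rho> k] \<rho>
      by (auto simp: distrib_right[symmetric] norm_triangle_ineq intro!: mult_right_mono)
  qed
qed (use assms in \<open>auto simp: A_supp\<close>)

lemma A_scale:
  assumes "f \<in> A" shows "(\<lambda>k. c * f k) \<in> A"
proof (rule AI)
  fix \<rho> assume \<rho>: "0 < \<rho>" "\<rho> < r"
  have "(\<lambda>k. norm c * (norm (f k) * w \<rho> k)) summable_on MI n"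
    using assms \<rho> by (intro summable_on_cmult_right A_summable)
  then show "(\<lambda>k. norm (c * f k) * w \<rho> k) summable_on MI n"
    by (simp add: norm_mult mult.assoc)
qed (use assms in \<open>auto simp: A_supp\<close>)

lemma A_diff: "f \<in> A \<Longrightarrow> g \<in> A \<Longrightarrow> (\<lambda>k. f k - g k) \<in> A"
  using A_add[of f "\<lambda>k. (- 1) * g k"] A_scale[of g "- 1"] by simp

lemma mon_A [simp]: assumes "k \<in> MI n" shows "mon k \<in> A"
proof (rule AI)
  fix \<rho> assume \<rho>: "0 < \<rho>" "\<rho> < r"
  have "(\<lambda>j. norm (mon k j) * w \<rho> j) summable_on {k}" by (rule summable_on_finite) simp
  then show "(\<lambda>j. norm (mon k j) * w \<rho> j) summable_on MI n"
    by (rule summable_on_cong_neutral[THEN iffD1, rotated -1]) (use assms in \<open>auto simp: mon_def\<close>)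
qed (use assms in \<open>auto simp: mon_def\<close>)

lemma N_mon: assumes "k \<in> MI n" shows "N \<rho> (mon k) = w \<rho> k"
proof -
  have "N \<rho> (mon k) = (\<Sum>\<^sub>\<infinity>j\<in>{k}. norm (mon k j) * w \<rho> j)"
    unfolding wnorm_def by (rule infsum_cong_neutral) (use assms in \<open>auto simp: mon_def\<close>)
  then show ?thesis by (simp add: mon_def)
qed

lemma N_nonneg: "0 < \<rho> \<Longrightarrow> \<rho> < r \<Longrightarrow> 0 \<le> N \<rho> f"
  unfolding wnorm_def by (intro infsum_nonneg mult_nonneg_nonneg) (auto intro: less_imp_le w_pos)

lemma N_mono:
  assumes "f \<in> A" "0 < \<rho>" "\<rho> \<le> \<sigma>" "\<sigma> < r" shows "N \<rho> f \<le> N \<sigma> f"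
  unfolding wnorm_def using assms
  by (intro infsum_mono A_summable mult_left_mono w_mono) auto

lemma N_triangle:
  assumes "f \<in> A" "g \<in> A" "0 < \<rho>" "\<rho> < r"
  shows "N \<rho> (\<lambda>k. f k + g k) \<le> N \<rho> f + N \<rho> g"
proof -
  have "N \<rho> (\<lambda>k. f k + g k) \<le> (\<Sum>\<^sub>\<infinity>k\<in>MI n. norm (f k) * w \<rho> k + norm (g k) * w \<rho> k)"
    unfolding wnorm_def
  proof (intro infsum_mono)
    show "(\<lambda>k. norm (f k + g k) * w \<rho> k) summable_on MI n"
      by (rule A_summable[OF A_add]) (use assms in auto)
    show "(\<lambda>k. norm (f k) * w \<rho> k + norm (g k) * w \<rho> k) summable_on MI n"
      using assms by (intro summable_on_add A_summable)
  next
    fix k assume "k \<in> MI n"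
    then show "norm (f k + g k) * w \<rho> k \<le> norm (f k) * w \<rho> k + norm (g k) * w \<rho> k"
      using w_pos[of \<rho> k] assms
      by (auto simp: distrib_right[symmetric] norm_triangle_ineq intro!: mult_right_mono)
  qed
  also have "\<dots> = N \<rho> f + N \<rho> g"
    unfolding wnorm_def using assms by (intro infsum_add A_summable)
  finally show ?thesis .
qed

lemma N_scale: "N \<rho> (\<lambda>k. c * f k) = norm c * N \<rho> f"
  unfolding wnorm_def by (simp add: norm_mult mult.assoc infsum_cmult_right')

lemma coeff_le_N:
  assumes "f \<in> A" "0 < \<rho>" "\<rho> < r" "k \<in> MI n"
  shows "norm (f k) * w \<rho> k \<le> N \<rho> f"
proof -
  have "(\<Sum>j\<in>{k}. norm (f j) * w \<rho> j) \<le> N \<rho> f"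
    unfolding wnorm_def
  proof (rule finite_sum_le_infsum)
    fix j assume "j \<in> MI n - {k}"
    then show "0 \<le> norm (f j) * w \<rho> j" using w_pos[of \<rho> j] assms by auto
  qed (use assms A_summable in auto)
  then show ?thesis by simp
qed

section \<open>Bounded functionals\<close>

text \<open>Linear and continuous for the family of norms; a single radius is enough because the
  norms increase with \<rho>.\<close>

definition bfun :: "(series \<Rightarrow> complex) \<Rightarrow> bool" where
  "bfun T \<longleftrightarrow> (\<forall>f\<in>A. \<forall>g\<in>A. T (\<lambda>k. f k + g k) = T f + T g)
     \<and> (\<forall>c. \<forall>f\<in>A. T (\<lambda>k. c * f k) = c * T f)
     \<and> (\<exists>C \<rho>. 0 < \<rho> \<and> \<rho> < r \<and> (\<forall>f\<in>A. norm (T f) \<le> C * N \<rho> f))"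

lemma bfunI:
  assumes "\<And>f g. f \<in> A \<Longrightarrow> g \<in> A \<Longrightarrow> T (\<lambda>k. f k + g k) = T f + T g"
    and "\<And>c f. f \<in> A \<Longrightarrow> T (\<lambda>k. c * f k) = c * T f"
    and "0 < \<rho>" "\<rho> < r" "\<And>f. f \<in> A \<Longrightarrow> norm (T f) \<le> C * N \<rho> f"
  shows "bfun T"
  unfolding bfun_def
proof (intro conjI ballI allI)
  show "\<exists>C \<rho>. 0 < \<rho> \<and> \<rho> < r \<and> (\<forall>f\<in>A. norm (T f) \<le> C * N \<rho> f)"
    by (rule exI[of _ C], rule exI[of _ \<rho>]) (use assms(3-5) in simp)
qed (use assms(1,2) in simp_all)

lemma bfun_add: "bfun T \<Longrightarrow> f \<in> A \<Longrightarrow> g \<in> A \<Longrightarrow> T (\<lambda>k. f k + g k) = T f + T g"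
  and bfun_scale: "bfun T \<Longrightarrow> f \<in> A \<Longrightarrow> T (\<lambda>k. c * f k) = c * T f"
  unfolding bfun_def by auto

lemma bfun_bound:
  assumes "bfun T"
  obtains C \<rho> where "0 \<le> C" "0 < \<rho>" "\<rho> < r" "\<And>f. f \<in> A \<Longrightarrow> norm (T f) \<le> C * N \<rho> f"
proof -
  obtain C \<rho> where C: "0 < \<rho>" "\<rho> < r" "\<And>f. f \<in> A \<Longrightarrow> norm (T f) \<le> C * N \<rho> f"
    using assms unfolding bfun_def by blast
  have "norm (T f) \<le> \<bar>C\<bar> * N \<rho> f" if "f \<in> A" for f
    using C(3)[OF that] N_nonneg[OF C(1,2), of f]
    by (meson abs_ge_self mult_right_mono order_trans)
  then show ?thesis using that[of "\<bar>C\<bar>" \<rho>] C by auto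
qed

lemma bfun_zero: "bfun T \<Longrightarrow> T (\<lambda>k. 0) = 0"
  using bfun_scale[of T "mon zidx" 0] by simp

lemma bfun_sum:
  assumes "bfun T" "finite F" "\<And>i. i \<in> F \<Longrightarrow> f i \<in> A"
  shows "(\<lambda>k. \<Sum>i\<in>F. f i k) \<in> A \<and> T (\<lambda>k. \<Sum>i\<in>F. f i k) = (\<Sum>i\<in>F. T (f i))"
  using assms(2,3)
proof (induction F rule: finite_induct)
  case empty
  then show ?case using bfun_zero[OF assms(1)] A_scale[of "mon zidx" 0] by simp
next
  case (insert x F)
  then show ?case using A_add[of "f x"] bfun_add[OF assms(1), of "f x"] by simp
qed

lemma bfun_coeff:
  assumes "k \<in> MI n" shows "bfun (\<lambda>f. f k)"
proof (rule bfunI)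
  let ?\<rho> = "r / 2"
  show \<rho>: "0 < ?\<rho>" "?\<rho> < r" using r_pos by auto
  fix f assume "f \<in> A"
  then show "norm (f k) \<le> (1 / w ?\<rho> k) * N ?\<rho> f"
    using coeff_le_N[of f ?\<rho> k] w_pos[of ?\<rho> k] \<rho> assms by (simp add: field_simps)
qed auto

lemma bfun_comb:
  assumes "bfun S" "bfun T" shows "bfun (\<lambda>f. a * S f + b * T f)"
proof -
  obtain C \<rho> where C: "0 \<le> C" "0 < \<rho>" "\<rho> < r" "\<And>f. f \<in> A \<Longrightarrow> norm (S f) \<le> C * N \<rho> f"
    using bfun_bound[OF assms(1)] by blast
  obtain D \<sigma> where D: "0 \<le> D" "0 < \<sigma>" "\<sigma> < r" "\<And>f. f \<in> A \<Longrightarrow> norm (T f) \<le> D * N \<sigma> f"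
    using bfun_bound[OF assms(2)] by blast
  show ?thesis
  proof (rule bfunI)
    fix f assume f: "f \<in> A"
    let ?m = "max \<rho> \<sigma>"
    have "norm (S f) \<le> C * N ?m f" using C(4)[OF f] N_mono[OF f, of \<rho> ?m] C D
      by (meson max.cobounded1 max_less_iff_conj mult_left_mono order_trans)
    moreover have "norm (T f) \<le> D * N ?m f" using D(4)[OF f] N_mono[OF f, of \<sigma> ?m] C D
      by (meson max.cobounded2 max_less_iff_conj mult_left_mono order_trans)
    ultimately have "norm a * norm (S f) + norm b * norm (T f)
        \<le> norm a * (C * N ?m f) + norm b * (D * N ?m f)"
      by (intro add_mono mult_left_mono) auto
    moreover have "norm (a * S f + b * T f) \<le> norm a * norm (S f) + norm b * norm (T f)"
      by (metis norm_mult norm_triangle_ineq)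
    ultimately show "norm (a * S f + b * T f) \<le> (norm a * C + norm b * D) * N ?m f"
      by (simp add: algebra_simps)
  qed (use assms C D in \<open>auto simp: bfun_add bfun_scale algebra_simps\<close>)
qed

lemma bfun_diff: "bfun S \<Longrightarrow> bfun T \<Longrightarrow> bfun (\<lambda>f. S f - T f)"
  using bfun_comb[of S T 1 "-1"] by simp

lemma bfun_lincomb:
  assumes "finite F" "\<And>i. i \<in> F \<Longrightarrow> bfun (T i)"
  shows "bfun (\<lambda>f. \<Sum>i\<in>F. a i * T i f)"
  using assms
proof (induction F rule: finite_induct)
  case empty
  then show ?case using bfun_comb[OF bfun_coeff[of zidx] bfun_coeff[of zidx], of 0 0] by simp
next
  case (insert x F)
  then show ?case using bfun_comb[of "T x" "\<lambda>f. \<Sum>i\<in>F. a i * T i f" "a x" 1] by simp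
qed

text \<open>The finite truncations of \<open>f\<close> converge to \<open>f\<close> in the norm that
  bounds \<open>T\<close>, since the tails of a convergent sum of nonnegative terms become small,
  and \<open>T\<close> kills every truncation.\<close>

lemma bfun_vanish:
  assumes T: "bfun T" and mon: "\<And>k. k \<in> MI n \<Longrightarrow> T (mon k) = 0" and f: "f \<in> A"
  shows "T f = 0"
proof -
  obtain C \<rho> where C: "0 \<le> C" "0 < \<rho>" "\<rho> < r" "\<And>f. f \<in> A \<Longrightarrow> norm (T f) \<le> C * N \<rho> f"
    using bfun_bound[OF T] by blast
  have "norm (T f) \<le> C * \<epsilon>" if \<epsilon>: "\<epsilon> > 0" for \<epsilon>
  proof -
    let ?a = "\<lambda>k. norm (f k) * w \<rho> k"
    have summ: "?a summable_on MI n" by (rule A_summable[OF f C(2,3)])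
    have "(?a has_sum N \<rho> f) (MI n)" unfolding wnorm_def using summ by simp
    then have "(sum ?a \<longlongrightarrow> N \<rho> f) (finite_subsets_at_top (MI n))" by (simp add: has_sum_def)
    then have "\<forall>\<^sub>F F in finite_subsets_at_top (MI n). dist (sum ?a F) (N \<rho> f) < \<epsilon>"
      using \<epsilon> by (rule tendstoD)
    then obtain F where F: "finite F" "F \<subseteq> MI n" "dist (sum ?a F) (N \<rho> f) < \<epsilon>"
      unfolding eventually_finite_subsets_at_top by blast
    let ?s = "\<lambda>k. \<Sum>j\<in>F. f j * mon j k"
    have s: "?s \<in> A" "T ?s = 0"
      using bfun_sum[OF T F(1), of "\<lambda>j k. f j * mon j k"] F mon
      by (auto simp: A_scale subset_iff bfun_scale[OF T])
    have s_eq: "?s k = (if k \<in> F then f k else 0)" for k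
    proof -
      have "?s k = (\<Sum>j\<in>F. if k = j then f j else 0)" by (rule sum.cong) (auto simp: mon_def)
      then show ?thesis using F by simp
    qed
    let ?g = "\<lambda>k. f k - ?s k"
    have g: "?g \<in> A" using A_diff[OF f s(1)] .
    have "T f = T ?g + T ?s" using bfun_add[OF T g s(1)] by simp
    then have "norm (T f) \<le> C * N \<rho> ?g" using s(2) C(4)[OF g] by simp
    also have "N \<rho> ?g = (\<Sum>\<^sub>\<infinity>k\<in>MI n - F. ?a k)"
      unfolding wnorm_def s_eq by (rule infsum_cong_neutral) auto
    also have "\<dots> = N \<rho> f - sum ?a F"
      unfolding wnorm_def using infsum_Diff[of ?a "MI n" F] summ F by (simp add: summable_on_finite)
    also have "C * \<dots> \<le> C * \<epsilon>" using F(3) C(1) by (intro mult_left_mono) (auto simp: dist_real_def)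
    finally show ?thesis .
  qed
  then have *: "norm (T f) \<le> C * \<epsilon>" if "\<epsilon> > 0" for \<epsilon> using that .
  have "norm (T f) \<le> 0 + \<epsilon>" if "\<epsilon> > 0" for \<epsilon>
  proof -
    \<comment> \<open>\<open>C\<close> may be 0, hence the denominator C + 1.\<close>
    have "norm (T f) \<le> C * (\<epsilon> / (C + 1))" using that C(1) by (intro *) auto
    also have "\<dots> \<le> \<epsilon>" using that C(1) by (simp add: field_simps)
    finally show ?thesis by simp
  qed
  then have "norm (T f) \<le> 0" by (rule field_le_epsilon)
  then show ?thesis by simp
qed

lemma mon_addi:
  assumes "k \<in> MI n" "l \<in> MI n" "q \<noteq> 0"
  shows "mon (addi k l) = (\<lambda>m. q ^ qexp n k l * qmul q n (mon k) (mon l) m)"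
  using assms(3) unfolding qmul_mon[OF assms(1,2)]
  by (simp add: power_inverse flip: mult.assoc)

text \<open>A bounded functional is determined by its values on monomials, and these are reached from 1
  by repeatedly multiplying with generators.\<close>

lemma bfun_vanish_gen:
  assumes T: "bfun T" and q: "q \<noteq> 0" and one: "T (mon zidx) = 0"
    and step: "\<And>i k. i < n \<Longrightarrow> k \<in> MI n \<Longrightarrow> T (mon k) = 0 \<Longrightarrow> T (qmul q n (gen i) (mon k)) = 0"
    and f: "f \<in> A"
  shows "T f = 0"
proof (rule bfun_vanish[OF T _ f])
  fix k assume "k \<in> MI n"
  then show "T (mon k) = 0"
  proof (induction rule: MI_induct)
    case (step i k)
    have ik: "unit_idx i \<in> MI n" "addi (unit_idx i) k \<in> MI n" using step by auto
    have "T (qmul q n (gen i) (mon k)) = inverse q ^ qexp n (unit_idx i) k * T (mon (addi (unit_idx i) k))"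
      unfolding qmul_mon[OF ik(1) step(2)] using ik by (intro bfun_scale[OF T]) simp
    then show ?case using assms(4)[OF step] q by simp
  qed (rule one)
qed

end

section \<open>Topologies given by families of norms\<close>

text \<open>\<open>topology\<close> yields the intended open sets only for a predicate that
  satisfies the axioms. For intersections, the two finite sets of radii are united and the smaller
  tolerance is taken.\<close>

lemma openin_sn_top:
  "openin (sn_top A N r) U \<longleftrightarrow> U \<subseteq> A \<and>
     (\<forall>f\<in>U. \<exists>F \<epsilon>. finite F \<and> F \<subseteq> {0<..<r} \<and> \<epsilon> > 0 \<and>
        {g \<in> A. \<forall>\<rho>\<in>F. N \<rho> (\<lambda>k. g k - f k) < \<epsilon>} \<subseteq> U)" (is "_ \<longleftrightarrow> ?P U")
proof -
  have "istopology ?P"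
    unfolding istopology_def
  proof (intro conjI allI impI)
    fix S T assume S: "?P S" and T: "?P T"
    show "S \<inter> T \<subseteq> A" using S by blast
    show "\<forall>f\<in>S \<inter> T. \<exists>F \<epsilon>. finite F \<and> F \<subseteq> {0<..<r} \<and> \<epsilon> > 0 \<and>
        {g \<in> A. \<forall>\<rho>\<in>F. N \<rho> (\<lambda>k. g k - f k) < \<epsilon>} \<subseteq> S \<inter> T"
    proof
      fix f assume f: "f \<in> S \<inter> T"
      from S f obtain F \<epsilon> where F: "finite F" "F \<subseteq> {0<..<r}" "\<epsilon> > 0"
        "{g \<in> A. \<forall>\<rho>\<in>F. N \<rho> (\<lambda>k. g k - f k) < \<epsilon>} \<subseteq> S" by blast
      from T f obtain G \<delta> where G: "finite G" "G \<subseteq> {0<..<r}" "\<delta> > 0"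
        "{g \<in> A. \<forall>\<rho>\<in>G. N \<rho> (\<lambda>k. g k - f k) < \<delta>} \<subseteq> T" by blast
      have "{g \<in> A. \<forall>\<rho>\<in>F \<union> G. N \<rho> (\<lambda>k. g k - f k) < min \<epsilon> \<delta>} \<subseteq> S \<inter> T"
        using F(4) G(4) by auto
      moreover have "finite (F \<union> G)" "F \<union> G \<subseteq> {0<..<r}" "min \<epsilon> \<delta> > 0" using F G by auto
      ultimately show "\<exists>F \<epsilon>. finite F \<and> F \<subseteq> {0<..<r} \<and> \<epsilon> > 0 \<and>
        {g \<in> A. \<forall>\<rho>\<in>F. N \<rho> (\<lambda>k. g k - f k) < \<epsilon>} \<subseteq> S \<inter> T" by blast
    qed
  next
    fix K assume K: "\<forall>S\<in>K. ?P S"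
    then show "\<Union>K \<subseteq> A" by blast
    show "\<forall>f\<in>\<Union>K. \<exists>F \<epsilon>. finite F \<and> F \<subseteq> {0<..<r} \<and> \<epsilon> > 0 \<and>
        {g \<in> A. \<forall>\<rho>\<in>F. N \<rho> (\<lambda>k. g k - f k) < \<epsilon>} \<subseteq> \<Union>K"
    proof
      fix f assume "f \<in> \<Union>K"
      then obtain S where "S \<in> K" "f \<in> S" by blast
      obtain F \<epsilon> where F: "finite F" "F \<subseteq> {0<..<r}" "\<epsilon> > 0"
        "{g \<in> A. \<forall>\<rho>\<in>F. N \<rho> (\<lambda>k. g k - f k) < \<epsilon>} \<subseteq> S"
        using bspec[OF conjunct2[OF bspec[OF K \<open>S \<in> K\<close>]] \<open>f \<in> S\<close>] by (elim exE conjE)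
      have "S \<subseteq> \<Union>K" using \<open>S \<in> K\<close> by blast
      with F show "\<exists>F \<epsilon>. finite F \<and> F \<subseteq> {0<..<r} \<and> \<epsilon> > 0 \<and>
        {g \<in> A. \<forall>\<rho>\<in>F. N \<rho> (\<lambda>k. g k - f k) < \<epsilon>} \<subseteq> \<Union>K"
        by (meson Union_upper order_trans)
    qed
  qed
  then show ?thesis unfolding sn_top_def by (subst topology_inverse') auto
qed

lemma topspace_sn_top: "topspace (sn_top A N r) = A"
proof -
  have "openin (sn_top A N r) A"
    unfolding openin_sn_top by (auto intro!: exI[of _ "{}"] exI[of _ "1::real"])
  moreover have "\<And>U. openin (sn_top A N r) U \<Longrightarrow> U \<subseteq> A" by (simp add: openin_sn_top)
  ultimately show ?thesis by (meson openin_subset openin_topspace subset_antisym)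
qed

text \<open>The preimage of the open unit ball of the target norm is open and contains 0, so it
  contains a basic neighbourhood of 0; homogeneity turns this into a norm estimate.\<close>

lemma (in weight) continuous_map_sn_top_bound:
  assumes w': "weight n w' r"
    and cont: "continuous_map (sn_top A N r) (sn_top (PS n w' r) (\<lambda>\<rho>. wnorm n (w' \<rho>)) r) \<phi>"
    and scale: "\<And>c f. f \<in> A \<Longrightarrow> \<phi> (\<lambda>k. c * f k) = (\<lambda>k. c * \<phi> f k)"
    and \<rho>: "0 < \<rho>" "\<rho> < r"
  shows "\<exists>C \<sigma>. 0 \<le> C \<and> 0 < \<sigma> \<and> \<sigma> < r \<and> (\<forall>f\<in>A. wnorm n (w' \<rho>) (\<phi> f) \<le> C * N \<sigma> f)"
proof -
  interpret B: weight n w' r by (rule w')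
  let ?X = "sn_top A N r" and ?Y = "sn_top (PS n w' r) (\<lambda>\<rho>. wnorm n (w' \<rho>)) r"
  let ?V = "{g \<in> B.A. B.N \<rho> g < 1}"
  have maps: "\<phi> f \<in> B.A" if "f \<in> A" for f
    using cont that by (auto simp: continuous_map_def topspace_sn_top Pi_iff)
  have "openin ?Y ?V"
    unfolding openin_sn_top
  proof (intro conjI ballI)
    fix f assume f: "f \<in> ?V"
    have "{g \<in> B.A. \<forall>\<rho>\<in>{\<rho>}. B.N \<rho> (\<lambda>k. g k - f k) < 1 - B.N \<rho> f} \<subseteq> ?V"
    proof clarsimp
      fix g assume g: "g \<in> B.A" "B.N \<rho> (\<lambda>k. g k - f k) < 1 - B.N \<rho> f"
      then show "B.N \<rho> g < 1"
        using B.N_triangle[OF B.A_diff[of g f], of f \<rho>] f \<rho> by simp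
    qed
    then show "\<exists>F \<epsilon>. finite F \<and> F \<subseteq> {0<..<r} \<and> \<epsilon> > 0 \<and>
        {g \<in> B.A. \<forall>\<rho>\<in>F. B.N \<rho> (\<lambda>k. g k - f k) < \<epsilon>} \<subseteq> ?V"
      using \<rho> f by (intro exI[of _ "{\<rho>}"] exI[of _ "1 - B.N \<rho> f"]) auto
  qed auto
  then have op: "openin ?X {f \<in> A. \<phi> f \<in> ?V}"
    using cont unfolding continuous_map_def topspace_sn_top by auto
  have zA: "(\<lambda>k. 0) \<in> A" using A_scale[of "mon zidx" 0] by simp
  have "\<phi> (\<lambda>k. 0) = (\<lambda>k. 0)" using scale[OF zA, of 0] by simp
  then have z: "(\<lambda>k. 0) \<in> {f \<in> A. \<phi> f \<in> ?V}"
    using zA maps[OF zA] by (auto simp: wnorm_def)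
  obtain F \<epsilon> where F: "finite F" "F \<subseteq> {0<..<r}" "\<epsilon> > 0"
    "{g \<in> A. \<forall>\<rho>\<in>F. N \<rho> (\<lambda>k. g k - 0) < \<epsilon>} \<subseteq> {f \<in> A. \<phi> f \<in> ?V}"
    using bspec[OF conjunct2[OF op[unfolded openin_sn_top]] z] by (elim exE conjE)
  \<comment> \<open>Inserting r / 2 covers the case of an empty \<open>F\<close>. By monotonicity
    the norm at \<sigma> dominates all those with radius in \<open>F\<close>.\<close>
  define \<sigma> where "\<sigma> = Max (insert (r / 2) F)"
  have \<sigma>_in: "\<sigma> \<in> insert (r / 2) F" unfolding \<sigma>_def using F(1) by (intro Max_in) auto
  have \<sigma>: "0 < \<sigma>" "\<sigma> < r" using \<sigma>_in F(2) r_pos by auto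
  have \<sigma>_ge: "\<tau> \<le> \<sigma>" if "\<tau> \<in> F" for \<tau> unfolding \<sigma>_def using F(1) that by (intro Max_ge) auto
  have "B.N \<rho> (\<phi> f) \<le> (1 / \<epsilon>) * N \<sigma> f" if f: "f \<in> A" for f
  proof (rule field_le_epsilon)
    fix e :: real assume e: "e > 0"
    \<comment> \<open>The summand e * \<epsilon> keeps \<open>t\<close> positive when the norm of
      \<open>f\<close> is 0 and makes the inequalities below strict.\<close>
    define t where "t = N \<sigma> f + e * \<epsilon>"
    have t: "t > N \<sigma> f" "t > 0" using e F(3) N_nonneg[OF \<sigma>, of f] by (auto simp: t_def add_nonneg_pos)
    have c: "norm (complex_of_real (\<epsilon> / t)) = \<epsilon> / t" using t F(3) by (simp add: norm_divide)
    have "N \<tau> (\<lambda>k. of_real (\<epsilon> / t) * f k) < \<epsilon>" if "\<tau> \<in> F" for \<tau>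
    proof -
      have "N \<tau> f < t" using N_mono[OF f, of \<tau> \<sigma>] \<sigma>_ge[OF that] F(2) that \<sigma> t by force
      then show ?thesis unfolding N_scale c using t F(3) by (simp add: field_simps)
    qed
    then have "(\<lambda>k. of_real (\<epsilon> / t) * f k) \<in> {g \<in> A. \<forall>\<rho>\<in>F. N \<rho> (\<lambda>k. g k - 0) < \<epsilon>}"
      using A_scale[OF f, of "of_real (\<epsilon> / t)"] by simp
    then have "B.N \<rho> (\<phi> (\<lambda>k. of_real (\<epsilon> / t) * f k)) < 1" using F(4) by blast
    then have "\<epsilon> / t * B.N \<rho> (\<phi> f) < 1" unfolding scale[OF f] B.N_scale c .
    then have "B.N \<rho> (\<phi> f) < t / \<epsilon>" using t F(3) by (simp add: field_simps)
    then show "B.N \<rho> (\<phi> f) \<le> 1 / \<epsilon> * N \<sigma> f + e" using F(3) by (simp add: t_def add_divide_distrib)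
  qed
  then show ?thesis using \<sigma> F(3) by (intro exI[of _ "1 / \<epsilon>"] exI[of _ \<sigma>]) auto
qed

section \<open>Cauchy products and the two concrete weights\<close>

text \<open>Fubini for an absolutely summable double family, reindexed by sending (k, l) to (k + l,
  k); the fibre over \<open>m\<close> is the finite set \<open>le_idx n m\<close>.\<close>

lemma cauchy_product_MI:
  fixes F G :: "(nat \<Rightarrow> nat) \<Rightarrow> 'a::{real_normed_field,banach}"
  assumes F: "(\<lambda>k. norm (F k)) summable_on MI n" and G: "(\<lambda>k. norm (G k)) summable_on MI n"
  shows "((\<lambda>m. \<Sum>k\<in>le_idx n m. F k * G (\<lambda>i. m i - k i)) has_sum
           (infsum F (MI n) * infsum G (MI n))) (MI n)"
proof -
  let ?h = "\<lambda>(k, l). F k * G l"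
  have "(\<lambda>x. norm (?h x)) summable_on (MI n \<times> MI n)"
    unfolding Infinite_Sum.abs_summable_on_Sigma_iff
  proof (intro conjI ballI)
    fix k
    show "(\<lambda>l. norm (?h (k, l))) summable_on MI n"
      using G by (auto simp: norm_mult intro: summable_on_cmult_right)
  next
    have "(\<lambda>k. norm (F k) * (\<Sum>\<^sub>\<infinity>l\<in>MI n. norm (G l))) summable_on MI n"
      using F by (rule summable_on_cmult_left)
    then show "(\<lambda>k. norm (\<Sum>\<^sub>\<infinity>l\<in>MI n. norm (?h (k, l)))) summable_on MI n"
      by (simp add: norm_mult infsum_cmult_right' abs_mult infsum_nonneg)
  qed
  then have "?h summable_on (MI n \<times> MI n)" by (rule abs_summable_summable)
  then obtain S where S: "(?h has_sum S) (MI n \<times> MI n)" by (auto simp: summable_on_def)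
  have sF: "(F has_sum infsum F (MI n)) (MI n)" and sG: "(G has_sum infsum G (MI n)) (MI n)"
    using assms by (auto dest: abs_summable_summable)
  have "((\<lambda>k. F k * infsum G (MI n)) has_sum S) (MI n)"
    by (rule has_sum_SigmaD[OF S]) (use sG in \<open>auto intro: has_sum_cmult_right\<close>)
  moreover have "((\<lambda>k. F k * infsum G (MI n)) has_sum (infsum F (MI n) * infsum G (MI n))) (MI n)"
    using sF by (rule has_sum_cmult_left)
  ultimately have S_eq: "S = infsum F (MI n) * infsum G (MI n)" by (rule has_sum_unique)
  have "((\<lambda>(m, k). F k * G (\<lambda>i. m i - k i)) has_sum S) (Sigma (MI n) (le_idx n))"
  proof (rule has_sum_reindex_bij_witness[THEN iffD1, OF _ _ _ _ _ _ S])
    fix a assume "a \<in> MI n \<times> MI n"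
    then show "(\<lambda>(m, k). (k, \<lambda>i. m i - k i)) ((\<lambda>(k, l). (addi k l, k)) a) = a"
      "(\<lambda>(k, l). (addi k l, k)) a \<in> Sigma (MI n) (le_idx n)"
      "(\<lambda>(m, k). F k * G (\<lambda>i. m i - k i)) ((\<lambda>(k, l). (addi k l, k)) a) = ?h a"
      by (auto simp: le_idx_def)
  next
    fix b assume "b \<in> Sigma (MI n) (le_idx n)"
    then show "(\<lambda>(k, l). (addi k l, k)) ((\<lambda>(m, k). (k, \<lambda>i. m i - k i)) b) = b"
      "(\<lambda>(m, k). (k, \<lambda>i. m i - k i)) b \<in> MI n \<times> MI n"
      using le_idx_add by (auto simp: le_idx_def fun_eq_iff)
  qed auto
  then have "((\<lambda>m. \<Sum>k\<in>le_idx n m. F k * G (\<lambda>i. m i - k i)) has_sum S) (MI n)"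
    by (rule has_sum_SigmaD) (auto intro!: has_sum_finite)
  then show ?thesis unfolding S_eq .
qed

lemma wD_add: "wD n \<rho> (addi k l) = wD n \<rho> k * wD n \<rho> l"
  by (simp add: wD_def power_add)

lemma weight_wD: "0 < r \<Longrightarrow> weight n (wD n) r"
  by unfold_locales (auto simp: wD_def intro: power_mono)

lemma weight_wB: "0 < r \<Longrightarrow> weight n (wB n) r"
proof
  fix \<rho> \<sigma> :: real and k :: "nat \<Rightarrow> nat"
  have p: "0 < (\<Prod>i<n. fact (k i)) / (fact (deg n k) :: real)"
    by (intro divide_pos_pos prod_pos) auto
  show "0 < wB n \<rho> k" if "0 < \<rho>" using that p by (simp add: wB_def)
  show "wB n \<rho> k \<le> wB n \<sigma> k" if "0 < \<rho>" "\<rho> \<le> \<sigma>"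
    unfolding wB_def using that p by (intro mult_left_mono power_mono) auto
qed auto

text \<open>As |q| = 1, the twist disappears from absolute values, and \<open>wD\<close> is
  multiplicative, so the Cauchy product of the weighted absolute series is a majorant. This puts
  products of values of the inverse isomorphism into the domain of the isomorphism, whence the
  inverse is multiplicative.\<close>

lemma OqD_qmul:
  assumes r: "0 < r" and q: "norm q = 1" and f: "f \<in> OqD n r" and g: "g \<in> OqD n r"
  shows "qmul q n f g \<in> OqD n r"
proof -
  interpret weight n "wD n" r by (rule weight_wD[OF r])
  have fA: "f \<in> A" and gA: "g \<in> A" using f g by (auto simp: OqD_def)
  have "qmul q n f g \<in> A"
  proof (rule AI)
    fix \<rho> assume \<rho>: "0 < \<rho>" "\<rho> < r"
    let ?F = "\<lambda>k. norm (f k) * wD n \<rho> k" and ?G = "\<lambda>k. norm (g k) * wD n \<rho> k"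
    have pos: "0 \<le> wD n \<rho> k" for k using \<rho> by (simp add: wD_def)
    have "(\<lambda>k. norm (?F k)) summable_on MI n" "(\<lambda>k. norm (?G k)) summable_on MI n"
      using A_summable[OF fA \<rho>] A_summable[OF gA \<rho>] pos by (auto simp: abs_mult)
    from cauchy_product_MI[OF this]
    have "(\<lambda>m. \<Sum>k\<in>le_idx n m. ?F k * ?G (\<lambda>i. m i - k i)) summable_on MI n"
      by (rule has_sum_imp_summable)
    then show "(\<lambda>m. norm (qmul q n f g m) * wD n \<rho> m) summable_on MI n"
    proof (rule summable_on_comparison_test)
      fix m assume m: "m \<in> MI n"
      have "norm (qmul q n f g m) * wD n \<rho> m
          \<le> (\<Sum>k\<in>le_idx n m. norm (f k) * norm (g (\<lambda>i. m i - k i))) * wD n \<rho> m"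
        unfolding qmul_altdef using m pos q
        by (auto intro!: mult_right_mono sum_norm_le simp: norm_mult norm_power norm_inverse)
      also have "\<dots> = (\<Sum>k\<in>le_idx n m. ?F k * ?G (\<lambda>i. m i - k i))"
        unfolding sum_distrib_right
      proof (rule sum.cong[OF refl])
        fix k assume "k \<in> le_idx n m"
        then have "wD n \<rho> m = wD n \<rho> k * wD n \<rho> (\<lambda>i. m i - k i)"
          using wD_add[of n \<rho> k "\<lambda>i. m i - k i"] le_idx_add by simp
        then show "norm (f k) * norm (g (\<lambda>i. m i - k i)) * wD n \<rho> m = ?F k * ?G (\<lambda>i. m i - k i)"
          by simp
      qed
      finally show "norm (qmul q n f g m) * wD n \<rho> m \<le> (\<Sum>k\<in>le_idx n m. ?F k * ?G (\<lambda>i. m i - k i))" .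
      show "0 \<le> norm (qmul q n f g m) * wD n \<rho> m" using pos by simp
    qed
  qed (rule qmul_supp)
  then show ?thesis by (simp add: OqD_def)
qed

section \<open>Bounded homomorphisms\<close>

text \<open>Continuity enters as norm estimates. Both weights are arbitrary, so that the locale
  serves for the inverse map as well.\<close>

locale hom = S: weight n w r + T: weight n w' r
  for n :: nat and w :: "real \<Rightarrow> (nat \<Rightarrow> nat) \<Rightarrow> real" and w' :: "real \<Rightarrow> (nat \<Rightarrow> nat) \<Rightarrow> real"
    and r :: real +
  fixes q :: complex and \<phi> :: "series \<Rightarrow> series"
  assumes norm_q: "norm q = 1"
    and maps: "f \<in> S.A \<Longrightarrow> \<phi> f \<in> T.A"
    and add: "f \<in> S.A \<Longrightarrow> g \<in> S.A \<Longrightarrow> \<phi> (\<lambda>k. f k + g k) = (\<lambda>k. \<phi> f k + \<phi> g k)"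
    and scale: "f \<in> S.A \<Longrightarrow> \<phi> (\<lambda>k. c * f k) = (\<lambda>k. c * \<phi> f k)"
    and mult: "f \<in> S.A \<Longrightarrow> g \<in> S.A \<Longrightarrow> \<phi> (qmul q n f g) = qmul q n (\<phi> f) (\<phi> g)"
    and one: "\<phi> (mon zidx) = mon zidx"
    and bound: "0 < \<rho> \<Longrightarrow> \<rho> < r \<Longrightarrow>
      \<exists>C \<sigma>. 0 \<le> C \<and> 0 < \<sigma> \<and> \<sigma> < r \<and> (\<forall>f\<in>S.A. T.N \<rho> (\<phi> f) \<le> C * S.N \<sigma> f)"
begin

lemma q_nonzero: "q \<noteq> 0" using norm_q by auto

text \<open>This transports coefficient functionals, characters and derivations of the target to the
  source, where their values on monomials determine them.\<close>

lemma bfun_comp: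
  assumes "T.bfun L" shows "S.bfun (\<lambda>f. L (\<phi> f))"
proof -
  obtain C \<rho> where C: "0 \<le> C" "0 < \<rho>" "\<rho> < r" "\<And>f. f \<in> T.A \<Longrightarrow> norm (L f) \<le> C * T.N \<rho> f"
    using T.bfun_bound[OF assms] by blast
  obtain D \<sigma> where D: "0 \<le> D" "0 < \<sigma>" "\<sigma> < r" "\<forall>f\<in>S.A. T.N \<rho> (\<phi> f) \<le> D * S.N \<sigma> f"
    using bound[OF C(2,3)] by (elim exE conjE)
  show ?thesis
  proof (rule S.bfunI)
    fix f assume f: "f \<in> S.A"
    have "norm (L (\<phi> f)) \<le> C * T.N \<rho> (\<phi> f)" using C(4) maps[OF f] by blast
    also have "\<dots> \<le> C * (D * S.N \<sigma> f)" using D(4) f C(1) by (intro mult_left_mono) auto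
    finally show "norm (L (\<phi> f)) \<le> (C * D) * S.N \<sigma> f" by simp
  qed (use D in \<open>auto simp: add scale T.bfun_add[OF assms] T.bfun_scale[OF assms] maps\<close>)
qed

lemma mon_add:
  assumes "k \<in> MI n" "l \<in> MI n"
  shows "\<phi> (mon (addi k l)) = (\<lambda>m. q ^ qexp n k l * qmul q n (\<phi> (mon k)) (\<phi> (mon l)) m)"
proof -
  have "qmul q n (mon k) (mon l) \<in> S.A"
    unfolding qmul_mon[OF assms] using assms by (intro S.A_scale S.mon_A) simp
  then show ?thesis
    unfolding S.mon_addi[OF assms q_nonzero] using assms by (simp add: scale mult)
qed

text \<open>Lowest-order terms multiply, and all powers of q have modulus 1; so only the modulus of
  the coefficient is tracked.\<close>

lemma lead_add:
  assumes "lead n (\<phi> (mon k)) K u" "lead n (\<phi> (mon l)) L v" "k \<in> MI n" "l \<in> MI n"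
  shows "\<exists>x. lead n (\<phi> (mon (addi k l))) (addi K L) x \<and> norm x = norm u * norm v"
proof -
  have "lead n (\<phi> (mon (addi k l))) (addi K L) (q ^ qexp n k l * (u * v * inverse q ^ qexp n K L))"
    unfolding mon_add[OF assms(3,4)] using lead_qmul[OF assms(1,2), of q] by (auto simp: lead_def)
  moreover have "norm (q ^ qexp n k l * (u * v * inverse q ^ qexp n K L)) = norm u * norm v"
    by (simp add: norm_mult norm_power norm_inverse norm_q)
  ultimately show ?thesis by blast
qed

lemma lead_gen_power:
  assumes "lead n (\<phi> (gen i)) (unit_idx l) a" "i < n"
  shows "\<exists>x. lead n (\<phi> (mon (\<lambda>j. m * unit_idx i j))) (\<lambda>j. m * unit_idx l j) x \<and> norm x = norm a ^ m"
proof (induction m)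
  case 0
  then show ?case using lead_mon[of zidx n] one by (intro exI[of _ 1]) simp
next
  case (Suc m)
  then obtain x where x: "lead n (\<phi> (mon (\<lambda>j. m * unit_idx i j))) (\<lambda>j. m * unit_idx l j) x"
    "norm x = norm a ^ m" by blast
  have "(\<lambda>j. m * unit_idx i j) \<in> MI n" using unit_idx_MI[OF assms(2)] by (simp add: MI_def)
  then show ?case using lead_add[OF assms(1) x(1)] assms(2) x(2) by simp
qed

text \<open>Taking the constant term is multiplicative, so both functionals vanish on any product
  with a generator on the left; they also agree at 1.\<close>

lemma const_coeff:
  assumes "\<And>i. i < n \<Longrightarrow> \<phi> (gen i) zidx = 0" and f: "f \<in> S.A"
  shows "\<phi> f zidx = f zidx"
proof -
  have "S.bfun (\<lambda>f. \<phi> f zidx - f zidx)"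
    by (intro S.bfun_diff bfun_comp S.bfun_coeff T.bfun_coeff) auto
  then have "\<phi> f zidx - f zidx = 0"
  proof (rule S.bfun_vanish_gen[OF _ q_nonzero _ _ f])
    fix i k assume "i < n" "k \<in> MI n"
    then show "\<phi> (qmul q n (gen i) (mon k)) zidx - qmul q n (gen i) (mon k) zidx = 0"
      using assms(1) by (simp add: mult qmul_zero_coeff)
  qed (simp add: one)
  then show ?thesis by simp
qed

text \<open>The chain rule at the origin, with the Jacobian of the images of the generators. On a
  product x_i x^k both sides reduce to the linear coefficient of \<open>\<phi> (gen i)\<close> times
  the constant term of x^k.\<close>

lemma linear_coeff:
  assumes "\<And>i. i < n \<Longrightarrow> \<phi> (gen i) zidx = 0" and f: "f \<in> S.A" and l: "l < n"
  shows "\<phi> f (unit_idx l) = (\<Sum>i<n. \<phi> (gen i) (unit_idx l) * f (unit_idx i))"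
proof -
  let ?L = "\<lambda>f. \<Sum>i<n. \<phi> (gen i) (unit_idx l) * f (unit_idx i)"
  have "S.bfun (\<lambda>f. \<phi> f (unit_idx l) - ?L f)"
    using l by (intro S.bfun_diff bfun_comp S.bfun_lincomb S.bfun_coeff T.bfun_coeff) auto
  then have "\<phi> f (unit_idx l) - ?L f = 0"
  proof (rule S.bfun_vanish_gen[OF _ q_nonzero _ _ f])
    fix i k assume ik: "i < n" "k \<in> MI n"
    have "?L (qmul q n (gen i) (mon k)) =
        (\<Sum>j<n. if j = i then \<phi> (gen i) (unit_idx l) * mon k zidx else 0)"
      by (rule sum.cong) (auto simp: qmul_unit_coeff)
    also have "\<dots> = \<phi> (gen i) (unit_idx l) * \<phi> (mon k) zidx"
      using ik const_coeff[OF assms(1), of "mon k"] by simp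
    also have "\<dots> = \<phi> (qmul q n (gen i) (mon k)) (unit_idx l)"
      using ik l assms(1) by (simp add: mult qmul_unit_coeff)
    finally show "\<phi> (qmul q n (gen i) (mon k)) (unit_idx l) - ?L (qmul q n (gen i) (mon k)) = 0"
      by simp
  qed (simp add: one)
  then show ?thesis by simp
qed

text \<open>The scalar is q or its inverse, according to the order of \<open>i\<close> and
  \<open>j\<close>; both differ from 1.\<close>

lemma q_commute:
  assumes "i < n" "j < n" "i \<noteq> j" "q \<noteq> 1"
  shows "\<exists>p. p \<noteq> 1 \<and> qmul q n (\<phi> (gen i)) (\<phi> (gen j)) = (\<lambda>m. p * qmul q n (\<phi> (gen j)) (\<phi> (gen i)) m)"
proof -
  have qe: "qexp n (unit_idx i) (unit_idx j) = (if j < i then 1 else 0)" if "i < n" for i j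
  proof -
    have "qexp n (unit_idx i) (unit_idx j) = (\<Sum>a<n. if a = i then \<Sum>b<i. unit_idx j b else 0)"
      unfolding qexp_def by (intro sum.cong refl) (auto simp: unit_idx_def)
    also have "\<dots> = (\<Sum>b<i. unit_idx j b)" using that by simp
    also have "\<dots> = (if j < i then 1 else 0)" by (simp add: unit_idx_def)
    finally show ?thesis .
  qed
  have main: "qmul q n (\<phi> (gen i)) (\<phi> (gen j)) = (\<lambda>m. q * qmul q n (\<phi> (gen j)) (\<phi> (gen i)) m)"
    if "i < j" "i < n" "j < n" for i j
  proof -
    have "qmul q n (gen i) (gen j) = (\<lambda>m. q * qmul q n (gen j) (gen i) m)"
      using that q_nonzero by (simp add: qmul_mon qe add.commute flip: mult.assoc)
    moreover have "qmul q n (gen j) (gen i) \<in> S.A"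
      unfolding qmul_mon[OF unit_idx_MI[OF that(3)] unit_idx_MI[OF that(2)]]
      using that by (intro S.A_scale S.mon_A) simp
    ultimately show ?thesis
      using that mult[of "gen i" "gen j"] mult[of "gen j" "gen i"]
        scale[of "qmul q n (gen j) (gen i)" q] by simp
  qed
  show ?thesis
  proof (cases "i < j")
    case True
    then show ?thesis using main assms by blast
  next
    case False
    then have "qmul q n (\<phi> (gen i)) (\<phi> (gen j)) = (\<lambda>m. inverse q * qmul q n (\<phi> (gen j)) (\<phi> (gen i)) m)"
      using main[of j i] assms q_nonzero by (simp flip: mult.assoc)
    then show ?thesis using assms(4) by (intro exI[of _ "inverse q"]) auto
  qed
qed

end

section \<open>The case of nontrivial q\<close>

lemma lead_unitI:
  assumes "K < n" "f zidx = 0" "\<And>j. j < n \<Longrightarrow> f (unit_idx j) = (if j = K then v else 0)"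
  shows "lead n f (unit_idx K) v"
  unfolding lead_def
proof (intro conjI ballI impI)
  fix k assume k: "k \<in> MI n" "deg n k \<le> deg n (unit_idx K)"
  then have "deg n k = 0 \<or> deg n k = 1" using assms(1) by auto
  then consider "k = zidx" | j where "j < n" "k = unit_idx j"
    using deg_eq_0[OF k(1)] deg_1[OF k(1)] by blast
  then show "f k = (if k = unit_idx K then v else 0)" by cases (use assms in auto)
qed (use assms in simp)

locale hom_iso = F: hom n w w' r q \<phi> + G: hom n w' w r q \<psi>
  for n w w' r q \<phi> \<psi> +
  assumes two_le: "2 \<le> n"
    and \<psi>\<phi>: "f \<in> F.S.A \<Longrightarrow> \<psi> (\<phi> f) = f"
    and \<phi>\<psi>: "f \<in> F.T.A \<Longrightarrow> \<phi> (\<psi> f) = f"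
begin

text \<open>If \<open>\<phi> (gen i)\<close> had a nonzero constant term, q-commutation would force
  the constant and linear coefficients of every other \<open>\<phi> (gen j)\<close> to vanish. All
  linear parts in the image would be multiples of one vector, although \<open>gen 0\<close> and
  \<open>gen 1\<close> both lie in the image.\<close>

lemma gen_const_zero:
  assumes q: "q \<noteq> 1" and "i < n"
  shows "\<phi> (gen i) zidx = 0"
proof (rule ccontr)
  assume nz: "\<phi> (gen i) zidx \<noteq> 0"
  have c0: "\<phi> (gen j) zidx = 0" and l0: "l < n \<Longrightarrow> \<phi> (gen j) (unit_idx l) = 0"
    if j: "j < n" "j \<noteq> i" for j l
  proof -
    obtain p where p: "p \<noteq> 1"
      "qmul q n (\<phi> (gen i)) (\<phi> (gen j)) = (\<lambda>m. p * qmul q n (\<phi> (gen j)) (\<phi> (gen i)) m)"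
      using F.q_commute[of i j] j q \<open>i < n\<close> by blast
    have "\<phi> (gen i) zidx * \<phi> (gen j) zidx = p * (\<phi> (gen i) zidx * \<phi> (gen j) zidx)"
      using fun_cong[OF p(2), of zidx] by (simp add: qmul_zero_coeff mult_ac)
    then show c: "\<phi> (gen j) zidx = 0" using p(1) nz by simp
    show "\<phi> (gen j) (unit_idx l) = 0" if "l < n"
    proof -
      have "\<phi> (gen i) zidx * \<phi> (gen j) (unit_idx l) = p * (\<phi> (gen i) zidx * \<phi> (gen j) (unit_idx l))"
        using fun_cong[OF p(2), of "unit_idx l"] that c by (simp add: qmul_unit_coeff mult_ac)
      then show ?thesis using p(1) nz by simp
    qed
  qed
  have lin: "F.S.bfun (\<lambda>f. \<phi> f (unit_idx l))" if "l < n" for l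
    using that by (intro F.bfun_comp F.T.bfun_coeff) simp
  \<comment> \<open>A linear form (a, b) in the first two linear coefficients that kills
    \<open>\<phi> (gen i)\<close> kills the whole image of \<phi>.\<close>
  have vanish: "a * \<phi> f (unit_idx 0) + b * \<phi> f (unit_idx 1) = 0"
    if ab: "a * \<phi> (gen i) (unit_idx 0) + b * \<phi> (gen i) (unit_idx 1) = 0" and f: "f \<in> F.S.A" for a b f
  proof (rule F.S.bfun_vanish_gen[OF _ F.q_nonzero _ _ f])
    show "F.S.bfun (\<lambda>f. a * \<phi> f (unit_idx 0) + b * \<phi> f (unit_idx 1))"
      using two_le by (intro F.S.bfun_comb lin) auto
    show "a * \<phi> (mon zidx) (unit_idx 0) + b * \<phi> (mon zidx) (unit_idx 1) = 0"
      by (simp add: F.one)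
  next
    fix j k
    assume jk: "j < n" "k \<in> MI n" and IH: "a * \<phi> (mon k) (unit_idx 0) + b * \<phi> (mon k) (unit_idx 1) = 0"
    let ?g = "\<phi> (gen j)" and ?h = "\<phi> (mon k)"
    have lj: "a * ?g (unit_idx 0) + b * ?g (unit_idx 1) = 0"
      using ab l0[of j 0] l0[of j 1] jk two_le by (cases "j = i") auto
    have "a * \<phi> (qmul q n (gen j) (mon k)) (unit_idx 0) + b * \<phi> (qmul q n (gen j) (mon k)) (unit_idx 1)
      = ?g zidx * (a * ?h (unit_idx 0) + b * ?h (unit_idx 1))
        + (a * ?g (unit_idx 0) + b * ?g (unit_idx 1)) * ?h zidx"
      using jk two_le by (simp add: F.mult qmul_unit_coeff algebra_simps)
    then show "a * \<phi> (qmul q n (gen j) (mon k)) (unit_idx 0)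
        + b * \<phi> (qmul q n (gen j) (mon k)) (unit_idx 1) = 0"
      using IH lj by simp
  qed
  have A01: "gen 0 \<in> F.T.A" "gen 1 \<in> F.T.A" using two_le by auto
  have inA: "\<psi> (gen 0) \<in> F.S.A" "\<psi> (gen 1) \<in> F.S.A" using A01 by (auto intro: G.maps)
  let ?b0 = "\<phi> (gen i) (unit_idx 0)" and ?b1 = "\<phi> (gen i) (unit_idx 1)"
  \<comment> \<open>The form (b1, -b0) kills (b0, b1). Evaluated at the two generators, which lie in
    the image, it gives b1 = 0 and b0 = 0; then the form (1, 0) kills the image too, although it is
    1 on \<open>gen 0\<close>.\<close>
  have "?b1 = 0" using vanish[of ?b1 "- ?b0" "\<psi> (gen 0)"] inA A01 by (simp add: \<phi>\<psi>)
  moreover have "?b0 = 0" using vanish[of ?b1 "- ?b0" "\<psi> (gen 1)"] inA A01 by (simp add: \<phi>\<psi>)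
  ultimately show False using vanish[of 1 0 "\<psi> (gen 0)"] inA A01 by (simp add: \<phi>\<psi>)
qed

text \<open>The Jacobians of \<phi> and \<psi> at 0 are mutually inverse. By q-commutation, two
  entries in one column of the first are never both nonzero, so it is a monomial matrix and its
  inverse has the reciprocal entries in the transposed places.\<close>

lemma leading_gen:
  assumes q: "q \<noteq> 1" and l: "l < n"
  shows "\<exists>i a. i < n \<and> a \<noteq> 0 \<and> lead n (\<phi> (gen i)) (unit_idx l) a
    \<and> lead n (\<psi> (gen l)) (unit_idx i) (inverse a)"
proof -
  define a where "a i j = \<phi> (gen i) (unit_idx j)" for i j
  define b where "b j i = \<psi> (gen j) (unit_idx i)" for i j
  note cz = gen_const_zero[OF q]
  have A: "gen j \<in> F.S.A" "gen j \<in> F.T.A" "\<psi> (gen j) \<in> F.S.A" "\<phi> (gen j) \<in> F.T.A" if "j < n" for j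
    using that by (auto intro: G.maps F.maps)
  have cz': "\<psi> (gen j) zidx = 0" if "j < n" for j
    using F.const_coeff[OF cz A(3)[OF that]] A[OF that] by (simp add: \<phi>\<psi>)
  have \<phi>\<psi>_lin: "(\<Sum>i<n. a i j' * b j i) = (if j' = j then 1 else 0)" if "j < n" "j' < n" for j j'
    using F.linear_coeff[OF cz A(3)[OF that(1)] that(2)] A(2)[OF that(1)] by (simp add: \<phi>\<psi> a_def b_def)
  have \<psi>\<phi>_lin: "(\<Sum>j<n. b j i' * a i j) = (if i' = i then 1 else 0)" if "i < n" "i' < n" for i i'
    using G.linear_coeff[OF cz' A(4)[OF that(1)] that(2)] A(1)[OF that(1)] by (simp add: \<psi>\<phi> a_def b_def)
  have disj: "a i j * a i' j = 0" if ij: "i < n" "i' < n" "i \<noteq> i'" "j < n" for i i' j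
  proof -
    obtain p where p: "p \<noteq> 1"
      "qmul q n (\<phi> (gen i)) (\<phi> (gen i')) = (\<lambda>m. p * qmul q n (\<phi> (gen i')) (\<phi> (gen i)) m)"
      using F.q_commute[OF ij(1-3) q] by blast
    have "a i j * a i' j = p * (a i j * a i' j)"
      using fun_cong[OF p(2), of "addi (unit_idx j) (unit_idx j)"] ij cz
      by (simp add: qmul_square_coeff a_def mult_ac)
    then show ?thesis using p(1) by simp
  qed
  have "\<exists>i<n. a i l \<noteq> 0"
  proof (rule ccontr)
    assume "\<not> ?thesis"
    then have "(\<Sum>i<n. a i l * b l i) = 0" by (intro sum.neutral) auto
    then show False using \<phi>\<psi>_lin[OF l l] by simp
  qed
  then obtain i where i: "i < n" "a i l \<noteq> 0" by blast
  have al: "a i' l = 0" if "i' < n" "i' \<noteq> i" for i'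
    using disj[of i i' l] i l that by auto
  have single: "(\<Sum>i'<n. a i' j' * b j i') = a i j' * b j i"
    if "\<And>i'. i' < n \<Longrightarrow> i' \<noteq> i \<Longrightarrow> a i' j' = 0" for j j'
  proof -
    have "(\<Sum>i'<n. a i' j' * b j i') = (\<Sum>i'<n. if i' = i then a i j' * b j i else 0)"
      using that by (intro sum.cong) auto
    then show ?thesis using i by simp
  qed
  have bl: "a i l * b l i = 1" using \<phi>\<psi>_lin[OF l l] single[OF al] by simp
  \<comment> \<open>Another nonzero entry in row \<open>i\<close> would confine column
    \<open>j\<close> to row \<open>i\<close> as well, and an off-diagonal entry of the matrix
    product would be a product of two nonzero numbers.\<close>
  have ai: "a i j = 0" if "j < n" "j \<noteq> l" for j
  proof (rule ccontr)
    assume nz: "a i j \<noteq> 0"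
    have "a i' j = 0" if "i' < n" "i' \<noteq> i" for i' using disj[of i i' j] i nz that \<open>j < n\<close> by auto
    then have "a i j * b l i = 0" using \<phi>\<psi>_lin[OF l \<open>j < n\<close>] single \<open>j \<noteq> l\<close> by simp
    then show False using nz bl by auto
  qed
  have bi: "b l i' = (if i' = i then inverse (a i l) else 0)" if i': "i' < n" for i'
  proof -
    have "(\<Sum>j<n. b j i' * a i j) = (\<Sum>j<n. if j = l then b l i' * a i l else 0)"
      using ai by (intro sum.cong) auto
    then have "b l i' * a i l = (if i' = i then 1 else 0)" using \<psi>\<phi>_lin[OF i(1) i'] l by simp
    then show ?thesis using i(2) by (auto simp: field_simps split: if_splits)
  qed
  have "lead n (\<phi> (gen i)) (unit_idx l) (a i l)"
    using i l ai cz by (intro lead_unitI) (auto simp: a_def)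
  moreover have "lead n (\<psi> (gen l)) (unit_idx i) (inverse (a i l))"
    using i l bi cz' by (intro lead_unitI) (auto simp: b_def)
  ultimately show ?thesis using i by blast
qed

end

section \<open>Growth of the norms of monomials\<close>

text \<open>A polynomial factor cannot compensate exponential growth. The exponent d = 0 serves for
  powers of a single monomial, d = n for sums over all monomials of a given degree.\<close>

lemma exp_growth_le:
  fixes x y C :: real
  assumes "0 \<le> x" "0 < y" and le: "\<And>m. x ^ m \<le> C * (real m + 1) ^ d * y ^ m"
  shows "x \<le> y"
proof (rule ccontr)
  assume "\<not> x \<le> y"
  define t where "t = x / y"
  have t: "t > 1" using \<open>\<not> x \<le> y\<close> assms(2) by (simp add: t_def)
  have "t ^ m \<le> C * (real m + 1) ^ d" for m
    using le[of m] assms(2) by (simp add: t_def power_divide field_simps)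
  moreover have "\<forall>\<^sub>F m in sequentially. C * (real m + 1) ^ d < t ^ m"
    using t by real_asymp
  ultimately show False
    by (meson eventually_sequentially le_refl not_less)
qed

lemma wB_unit_multiple:
  assumes "i < n" shows "wB n \<rho> (\<lambda>j. m * unit_idx i j) = \<rho> ^ m"
proof -
  have d: "deg n (\<lambda>j. m * unit_idx i j) = m"
    using deg_unit_idx[OF assms] by (simp add: deg_def flip: sum_distrib_left)
  have "(\<Prod>j<n. fact (m * unit_idx i j)) = (\<Prod>j<n. if j = i then fact m else (1::real))"
    by (intro prod.cong) (auto simp: unit_idx_def)
  also have "\<dots> = fact m" using assms by simp
  finally show ?thesis by (simp add: wB_def d)
qed

lemma wD_unit_multiple:
  assumes "i < n" shows "wD n \<rho> (\<lambda>j. m * unit_idx i j) = \<rho> ^ m"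
  using deg_unit_idx[OF assms] by (simp add: wD_def deg_def flip: sum_distrib_left)

text \<open>The central binomial coefficient is at least 2^m: each step multiplies it by 2 (2m + 1)
  / (m + 1) >= 2.\<close>

lemma fact_double_ge: "2 ^ m * (fact m * fact m) \<le> (fact (2 * m) :: real)"
proof (induction m)
  case (Suc m)
  have "2 ^ Suc m * (fact (Suc m) * fact (Suc m)) =
      (2 * (real m + 1) * (real m + 1)) * (2 ^ m * (fact m * fact m) :: real)"
    by (simp add: algebra_simps)
  also have "\<dots> \<le> ((2 * real m + 2) * (2 * real m + 1)) * fact (2 * m)"
    using Suc by (intro mult_mono) (auto simp: algebra_simps)
  also have "\<dots> = fact (2 * Suc m)" by (simp add: algebra_simps)
  finally show ?case .
qed simp

text \<open>Products of powers of two distinct variables are where ball and polydisc norms differ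
  exponentially. Squaring avoids the root in \<open>wB\<close>.\<close>

lemma wB_pair_square_le:
  assumes "i < n" "l < n" "i \<noteq> l"
  shows "(wB n \<rho> (addi (\<lambda>j. m * unit_idx i j) (\<lambda>j. m * unit_idx l j)))\<^sup>2 \<le> (\<rho> ^ 4 / 2) ^ m"
proof -
  let ?k = "addi (\<lambda>j. m * unit_idx i j) (\<lambda>j. m * unit_idx l j)"
  have d: "deg n ?k = 2 * m"
    unfolding deg_add using deg_unit_idx[OF assms(1)] deg_unit_idx[OF assms(2)]
    by (simp add: deg_def flip: sum_distrib_left)
  have "(\<Prod>j<n. fact (?k j)) = (\<Prod>j<n. (if j = i then fact m else 1) * (if j = l then fact m else (1::real)))"
    using assms by (intro prod.cong) (auto simp: unit_idx_def)
  also have "\<dots> = fact m * fact m" using assms by (simp add: prod.distrib)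
  finally have p: "(\<Prod>j<n. fact (?k j)) = (fact m * fact m :: real)" .
  have "(wB n \<rho> ?k)\<^sup>2 = (fact m * fact m) / fact (2 * m) * (\<rho> ^ (2 * m))\<^sup>2"
    unfolding wB_def d p by (simp add: power_mult_distrib)
  also have "\<dots> \<le> (1 / 2 ^ m) * (\<rho> ^ (2 * m))\<^sup>2"
    using fact_double_ge[of m] by (intro mult_right_mono) (auto simp: field_simps)
  also have "\<dots> = (\<rho> ^ 4 / 2) ^ m"
    by (simp add: power_divide mult.commute flip: power_mult)
  finally show ?thesis .
qed

lemma lead_coeff_bound:
  assumes "weight n w r" "f \<in> PS n w r" "lead n f K v" "0 < \<rho>" "\<rho> < r"
  shows "norm v * w \<rho> K \<le> wnorm n (w \<rho>) f"
proof -
  interpret weight n w r by fact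
  have "f K = v" "K \<in> MI n" using assms(3) by (auto simp: lead_def)
  then show ?thesis using coeff_le_N[of f \<rho> K] assms by simp
qed

lemma no_iso_nontrivial_q:
  assumes "hom_iso n (wD n) (wB n) r q \<phi> \<psi>" and q: "q \<noteq> 1"
  shows False
proof -
  interpret hom_iso n "wD n" "wB n" r q \<phi> \<psi> by fact
  \<comment> \<open>Powers of one variable have the same norm in both algebras, so the leading term
    of the image of x_i^m, with coefficient of modulus |a|^m, gives |a| \<rho> <= \<sigma> < r for
    every \<rho> < r.\<close>
  have norm_ge: "norm a \<le> 1" if i: "i < n" and l: "l < n" and a: "lead n (\<phi> (gen i)) (unit_idx l) a" for i l a
  proof -
    have "norm a * \<rho> \<le> r" if \<rho>: "0 < \<rho>" "\<rho> < r" for \<rho>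
    proof -
      obtain C \<sigma> where C: "0 \<le> C" "0 < \<sigma>" "\<sigma> < r" "\<forall>f\<in>F.S.A. F.T.N \<rho> (\<phi> f) \<le> C * F.S.N \<sigma> f"
        using F.bound[OF \<rho>] by (elim exE conjE)
      have "norm a * \<rho> \<le> \<sigma>"
      proof (rule exp_growth_le[of _ _ C 0])
        fix m
        obtain x where x: "lead n (\<phi> (mon (\<lambda>j. m * unit_idx i j))) (\<lambda>j. m * unit_idx l j) x"
          "norm x = norm a ^ m" using F.lead_gen_power[OF a i] by blast
        have mi: "(\<lambda>j. m * unit_idx i j) \<in> MI n" using unit_idx_MI[OF i] by (simp add: MI_def)
        then have m: "mon (\<lambda>j. m * unit_idx i j) \<in> F.S.A" by simp
        have "norm x * wB n \<rho> (\<lambda>j. m * unit_idx l j) \<le> F.T.N \<rho> (\<phi> (mon (\<lambda>j. m * unit_idx i j)))"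
          by (rule lead_coeff_bound[OF F.T.weight_axioms F.maps[OF m] x(1) \<rho>])
        also have "\<dots> \<le> C * F.S.N \<sigma> (mon (\<lambda>j. m * unit_idx i j))" using C(4) m by blast
        also have "\<dots> = C * \<sigma> ^ m" using F.S.N_mon[OF mi] i by (simp add: wD_unit_multiple)
        finally show "(norm a * \<rho>) ^ m \<le> C * (real m + 1) ^ 0 * \<sigma> ^ m"
          using x(2) l by (simp add: wB_unit_multiple power_mult_distrib)
      qed (use \<rho> C in auto)
      then show ?thesis using C by simp
    qed
    note le = this
    show ?thesis
    proof (rule ccontr)
      assume "\<not> ?thesis"
      then have a1: "1 < norm a" by simp
      \<comment> \<open>The midpoint between r / |a| and r, at which |a| \<rho> exceeds r.\<close>
      define \<rho> where "\<rho> = (r / norm a + r) / 2"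
      have a0: "0 < norm a" using a1 by linarith
      have "r / norm a < r" unfolding pos_divide_less_eq[OF a0] using a1 F.S.r_pos by simp
      moreover have "0 < r / norm a" using a0 F.S.r_pos by (rule divide_pos_pos[rotated])
      ultimately have "norm a * \<rho> \<le> r" by (intro le) (auto simp: \<rho>_def)
      moreover have "norm a * \<rho> = (r + norm a * r) / 2" using a0 by (simp add: \<rho>_def field_simps)
      moreover have "r < norm a * r" using a1 F.S.r_pos by simp
      then have "r < (r + norm a * r) / 2" by (simp add: field_simps)
      ultimately show False by simp
    qed
  qed
  have n: "0 < n" "1 < n" using two_le by auto
  obtain i a where i: "i < n" "a \<noteq> 0" "lead n (\<phi> (gen i)) (unit_idx 0) a"
      "lead n (\<psi> (gen 0)) (unit_idx i) (inverse a)"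
    using leading_gen[OF q n(1)] by blast
  obtain j b where j: "j < n" "b \<noteq> 0" "lead n (\<phi> (gen j)) (unit_idx 1) b"
      "lead n (\<psi> (gen 1)) (unit_idx j) (inverse b)"
    using leading_gen[OF q n(2)] by blast
  have ab: "1 \<le> norm (inverse a)" "1 \<le> norm (inverse b)"
    using norm_ge[OF i(1) n(1) i(3)] norm_ge[OF j(1) n(2) j(3)] i(2) j(2)
    by (auto simp: norm_inverse one_le_inverse_iff)
  \<comment> \<open>Any \<rho> < r with 2 \<rho>^4 >= r^4 would do; here 2 (9/10)^4 =
    1.3122.\<close>
  define \<rho> where "\<rho> = 9 / 10 * r"
  have \<rho>: "0 < \<rho>" "\<rho> < r" using F.S.r_pos by (auto simp: \<rho>_def)
  obtain C \<sigma> where C: "0 \<le> C" "0 < \<sigma>" "\<sigma> < r" "\<forall>f\<in>F.T.A. F.S.N \<rho> (\<psi> f) \<le> C * F.T.N \<sigma> f"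
    using G.bound[OF \<rho>] by (elim exE conjE)
  \<comment> \<open>The image under \<psi> of the product of the m-th powers of the first two
    generators has a leading coefficient of modulus at least 1 at a monomial of weight \<rho>^(2m),
    while the squared ball norm of that product is at most (\<sigma>^4 / 2)^m.\<close>
  have "2 * \<rho> ^ 4 \<le> \<sigma> ^ 4"
  proof (rule exp_growth_le[of _ _ "C\<^sup>2" 0])
    fix m
    let ?k0 = "\<lambda>j. m * unit_idx 0 j" and ?k1 = "\<lambda>j. m * unit_idx 1 j"
    have mi: "?k0 \<in> MI n" "?k1 \<in> MI n" "addi ?k0 ?k1 \<in> MI n"
      using unit_idx_MI[OF n(1)] unit_idx_MI[OF n(2)] by (simp_all add: MI_def)
    have m: "mon (addi ?k0 ?k1) \<in> F.T.A" using F.T.mon_A[OF mi(3)] .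
    obtain x where x: "lead n (\<psi> (mon ?k0)) (\<lambda>l. m * unit_idx i l) x" "norm x = norm (inverse a) ^ m"
      using G.lead_gen_power[OF i(4) n(1)] by blast
    obtain y where y: "lead n (\<psi> (mon ?k1)) (\<lambda>l. m * unit_idx j l) y" "norm y = norm (inverse b) ^ m"
      using G.lead_gen_power[OF j(4) n(2)] by blast
    obtain z where z: "lead n (\<psi> (mon (addi ?k0 ?k1))) (addi (\<lambda>l. m * unit_idx i l) (\<lambda>l. m * unit_idx j l)) z"
      "norm z = norm x * norm y"
      using G.lead_add[OF x(1) y(1) mi(1,2)] by blast
    have z1: "1 \<le> norm z" unfolding z(2) x(2) y(2)
      using mult_mono[OF one_le_power[OF ab(1), of m] one_le_power[OF ab(2), of m]] by simp
    have w: "wD n \<rho> (addi (\<lambda>l. m * unit_idx i l) (\<lambda>l. m * unit_idx j l)) = \<rho> ^ (2 * m)"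
      using i(1) j(1) by (simp add: wD_add wD_unit_multiple mult_2 power_add)
    have "\<rho> ^ (2 * m) \<le> norm z * \<rho> ^ (2 * m)" using z1 \<rho> by simp
    also have "\<dots> \<le> F.S.N \<rho> (\<psi> (mon (addi ?k0 ?k1)))"
      using lead_coeff_bound[OF F.S.weight_axioms G.maps[OF m] z(1) \<rho>] w by simp
    also have "\<dots> \<le> C * F.T.N \<sigma> (mon (addi ?k0 ?k1))" using C(4) m by blast
    also have "\<dots> = C * wB n \<sigma> (addi ?k0 ?k1)" using F.T.N_mon[OF mi(3)] by simp
    finally have "(\<rho> ^ (2 * m))\<^sup>2 \<le> (C * wB n \<sigma> (addi ?k0 ?k1))\<^sup>2"
      using \<rho> by (intro power_mono) auto
    also have "\<dots> \<le> C\<^sup>2 * (\<sigma> ^ 4 / 2) ^ m"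
      unfolding power_mult_distrib using wB_pair_square_le[OF n(1,2)] by (intro mult_left_mono) auto
    finally have "(\<rho> ^ 4) ^ m \<le> C\<^sup>2 * ((\<sigma> ^ 4) ^ m / 2 ^ m)"
      by (simp add: power_divide mult.commute flip: power_mult)
    then show "(2 * \<rho> ^ 4) ^ m \<le> C\<^sup>2 * (real m + 1) ^ 0 * (\<sigma> ^ 4) ^ m"
      by (simp add: power_mult_distrib field_simps)
  qed (use \<rho> C in auto)
  also have "\<sigma> ^ 4 < r ^ 4" using C by (intro power_strict_mono) auto
  finally have "2 * (9 / 10) ^ 4 * r ^ 4 < r ^ 4" 
    unfolding \<rho>_def power_mult_distrib by (simp only: mult.assoc)
  moreover have "r ^ 4 \<le> 2 * (9 / 10) ^ 4 * r ^ 4" using F.S.r_pos by (simp add: power4_eq_xxxx)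
  ultimately show False by simp
qed

section \<open>The commutative case\<close>

definition mev :: "nat \<Rightarrow> (nat \<Rightarrow> complex) \<Rightarrow> (nat \<Rightarrow> nat) \<Rightarrow> complex" where
  "mev n z k = (\<Prod>i<n. z i ^ k i)"

definition ev :: "nat \<Rightarrow> (nat \<Rightarrow> complex) \<Rightarrow> series \<Rightarrow> complex" where
  "ev n z f = (\<Sum>\<^sub>\<infinity>k\<in>MI n. f k * mev n z k)"

lemma mev_zidx [simp]: "mev n z zidx = 1"
  by (simp add: mev_def)

lemma mev_add: "mev n z (addi k l) = mev n z k * mev n z l"
  by (simp add: mev_def power_add prod.distrib)

lemma mev_unit_multiple:
  assumes "i < n" shows "mev n z (\<lambda>j. m * unit_idx i j) = z i ^ m"
proof -
  have "mev n z (\<lambda>j. m * unit_idx i j) = (\<Prod>j<n. if j = i then z i ^ m else 1)"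
    unfolding mev_def by (intro prod.cong) (auto simp: unit_idx_def)
  then show ?thesis using assms by simp
qed

lemma mev_unit [simp]: "i < n \<Longrightarrow> mev n z (unit_idx i) = z i"
  using mev_unit_multiple[of i n z 1] by simp

lemma norm_mev: "norm (mev n z k) = (\<Prod>i<n. norm (z i) ^ k i)"
  by (simp add: mev_def norm_power flip: prod_norm)

text \<open>The multinomial theorem divided by N!. In this form, splitting off the last exponent j =
  \<open>k n\<close> turns the induction on \<open>n\<close> into the binomial theorem.\<close>

lemma multinomial_fact:
  fixes a :: "nat \<Rightarrow> real"
  shows "(\<Sum>k\<in>{k \<in> MI n. deg n k = N}. \<Prod>i<n. a i ^ k i / fact (k i)) = (\<Sum>i<n. a i) ^ N / fact N"
proof (induction n arbitrary: N)
  case 0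
  have "MI 0 = {zidx}" by (auto simp: MI_def)
  then have "{k \<in> MI 0. deg 0 k = N} = (if N = 0 then {zidx} else {})" by (auto simp: deg_def)
  then show ?case by simp
next
  case (Suc n)
  let ?L = "\<lambda>n N. {k \<in> MI n. deg n k = N}"
  let ?t = "\<lambda>n k. \<Prod>i<n. a i ^ k i / fact (k i)"
  have t: "?t n (k(n := j)) = ?t n k" for k j by (intro prod.cong) auto
  have d: "deg n (k(n := j)) = deg n k" for k j unfolding deg_def by (intro sum.cong) auto
  have "sum (?t (Suc n)) (?L (Suc n) N) =
      (\<Sum>(j, k)\<in>Sigma {..N} (\<lambda>j. ?L n (N - j)). a n ^ j / fact j * ?t n k)"
  proof (rule sum.reindex_bij_witness[where i = "\<lambda>(j, k). k(n := j)" and j = "\<lambda>k. (k n, k(n := 0))"])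
    fix k assume k: "k \<in> ?L (Suc n) N"
    then have "deg n k + k n = N" by (simp add: deg_def)
    then show "(k n, k(n := 0)) \<in> Sigma {..N} (\<lambda>j. ?L n (N - j))"
      using k by (auto simp: MI_def d le_Suc_eq)
    show "(case (k n, k(n := 0)) of (j, k) \<Rightarrow> k(n := j)) = k" by simp
    show "(case (k n, k(n := 0)) of (j, k) \<Rightarrow> a n ^ j / fact j * ?t n k) = ?t (Suc n) k"
      by (simp add: t mult.commute del: times_divide_eq_left times_divide_eq_right)
  next
    fix b assume "b \<in> Sigma {..N} (\<lambda>j. ?L n (N - j))"
    then obtain j k where b: "b = (j, k)" "j \<le> N" "k \<in> MI n" "deg n k = N - j" by auto
    have "deg (Suc n) (k(n := j)) = deg n (k(n := j)) + j" by (simp add: deg_def)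
    then show "(case b of (j, k) \<Rightarrow> k(n := j)) \<in> ?L (Suc n) N" using b by (auto simp: MI_def d)
    have "k n = 0" using b by (simp add: MI_def)
    then show "(\<lambda>k. (k n, k(n := 0))) (case b of (j, k) \<Rightarrow> k(n := j)) = b"
      using b by (auto simp: fun_eq_iff)
  qed
  also have "\<dots> = (\<Sum>j\<le>N. a n ^ j / fact j * ((\<Sum>i<n. a i) ^ (N - j) / fact (N - j)))"
    unfolding Suc[symmetric] sum_distrib_left by (subst sum.Sigma) auto
  also have "\<dots> = (\<Sum>j\<le>N. real (N choose j) * a n ^ j * (\<Sum>i<n. a i) ^ (N - j)) / fact N"
    unfolding sum_divide_distrib
    by (intro sum.cong refl) (simp add: binomial_fact field_simps)
  also have "\<dots> = (a n + (\<Sum>i<n. a i)) ^ N / fact N" by (simp only: binomial_ring)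
  finally show ?case by (simp add: add.commute)
qed

text \<open>The factor N! / k! is the reciprocal of the squared factor in the ball norm; this is how
  the Euclidean length of \<open>z\<close> enters.\<close>

lemma multinomial_weighted:
  fixes z :: "nat \<Rightarrow> complex"
  shows "(\<Sum>k\<in>{k \<in> MI n. deg n k = N}. (norm (mev n z k))\<^sup>2 * (fact N / (\<Prod>i<n. fact (k i)))) =
    (\<Sum>i<n. (norm (z i))\<^sup>2) ^ N"
proof -
  have "(norm (mev n z k))\<^sup>2 * (fact N / (\<Prod>i<n. fact (k i))) =
      fact N * (\<Prod>i<n. ((norm (z i))\<^sup>2) ^ k i / fact (k i))" for k
    by (simp add: norm_mev prod_dividef prod_power_distrib mult.commute flip: power_mult)
  then show ?thesis
    by (simp add: multinomial_fact flip: sum_distrib_left)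
qed

lemma wB_square:
  "(wB n \<rho> k)\<^sup>2 = (\<Prod>i<n. fact (k i)) / fact (deg n k) * (\<rho>\<^sup>2) ^ deg n k"
  unfolding wB_def power_mult_distrib
  by (simp add: prod_nonneg mult.commute flip: power_mult)

text \<open>A single term of the multinomial sum is at most the whole sum.\<close>

lemma mev_le_wB:
  assumes k: "k \<in> MI n" and \<rho>: "0 \<le> \<rho>" "(\<Sum>i<n. (norm (z i))\<^sup>2) \<le> \<rho>\<^sup>2"
  shows "norm (mev n z k) \<le> wB n \<rho> k"
proof -
  let ?P = "\<Prod>i<n. fact (k i) :: real"
  have P: "0 < ?P" by (intro prod_pos) auto
  have "(norm (mev n z k))\<^sup>2 * (fact (deg n k) / ?P) \<le> (\<Sum>i<n. (norm (z i))\<^sup>2) ^ deg n k"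
    unfolding multinomial_weighted[symmetric]
    by (rule member_le_sum) (use k in \<open>auto simp: prod_nonneg\<close>)
  also have "\<dots> \<le> (\<rho>\<^sup>2) ^ deg n k" using \<rho> by (intro power_mono sum_nonneg) auto
  finally have "(norm (mev n z k))\<^sup>2 \<le> (wB n \<rho> k)\<^sup>2"
    unfolding wB_square using P by (simp add: field_simps)
  moreover have "0 \<le> wB n \<rho> k" using \<rho> P by (simp add: wB_def)
  ultimately show ?thesis by (rule power2_le_imp_le)
qed

text \<open>A converse of the previous estimate that tolerates a constant: summing the squared
  bounds over degree \<open>N\<close> gives |z|^(2N) on the left and polynomially many equal terms
  on the right.\<close>

lemma sum_squares_le_of_wB_bound:
  assumes \<rho>: "0 < \<rho>" and le: "\<And>k. k \<in> MI n \<Longrightarrow> norm (mev n z k) \<le> C * wB n \<rho> k"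
  shows "(\<Sum>i<n. (norm (z i))\<^sup>2) \<le> \<rho>\<^sup>2"
proof (rule exp_growth_le)
  fix N
  let ?L = "{k \<in> MI n. deg n k = N}"
  have "(\<Sum>i<n. (norm (z i))\<^sup>2) ^ N =
      (\<Sum>k\<in>?L. (norm (mev n z k))\<^sup>2 * (fact N / (\<Prod>i<n. fact (k i))))"
    by (rule multinomial_weighted[symmetric])
  also have "\<dots> \<le> (\<Sum>k\<in>?L. C\<^sup>2 * (\<rho>\<^sup>2) ^ N)"
  proof (rule sum_mono)
    fix k assume k: "k \<in> ?L"
    have P: "0 < (\<Prod>i<n. fact (k i) :: real)" by (intro prod_pos) auto
    have "(norm (mev n z k))\<^sup>2 \<le> (C * wB n \<rho> k)\<^sup>2" using le k by (intro power_mono) auto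
    also have "\<dots> = C\<^sup>2 * ((\<Prod>i<n. fact (k i)) / fact N * (\<rho>\<^sup>2) ^ N)"
      using k by (simp add: power_mult_distrib wB_square)
    finally show "(norm (mev n z k))\<^sup>2 * (fact N / (\<Prod>i<n. fact (k i))) \<le> C\<^sup>2 * (\<rho>\<^sup>2) ^ N"
      using P by (simp add: field_simps)
  qed
  also have "\<dots> = real (card ?L) * (C\<^sup>2 * (\<rho>\<^sup>2) ^ N)" by simp
  also have "\<dots> \<le> (real N + 1) ^ n * (C\<^sup>2 * (\<rho>\<^sup>2) ^ N)"
  proof (intro mult_right_mono)
    have "real (card ?L) \<le> real ((N + 1) ^ n)" using card_deg_level by (intro of_nat_mono)
    then show "real (card ?L) \<le> (real N + 1) ^ n" by (simp add: add.commute)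
  qed auto
  finally show "(\<Sum>i<n. (norm (z i))\<^sup>2) ^ N \<le> C\<^sup>2 * (real N + 1) ^ n * (\<rho>\<^sup>2) ^ N"
    by (simp add: mult_ac)
qed (use \<rho> in \<open>auto intro: sum_nonneg\<close>)

lemma mev_le_wD:
  assumes "\<And>i. i < n \<Longrightarrow> norm (z i) \<le> \<rho>"
  shows "norm (mev n z k) \<le> wD n \<rho> k"
proof -
  have "norm (mev n z k) \<le> (\<Prod>i<n. \<rho> ^ k i)"
    unfolding norm_mev using assms by (intro prod_mono) (auto intro: power_mono)
  then show ?thesis by (simp add: wD_def deg_def power_sum)
qed

section \<open>Derivative estimates in one variable\<close>

text \<open>Cauchy's inequality asks for continuity up to the boundary, so it is applied on radii t
  < s, and t then approaches s.\<close>

lemma cauchy_deriv_bound: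
  assumes h: "h holomorphic_on ball 0 s" and s: "0 < s" and B: "\<And>\<zeta>. \<zeta> \<in> ball 0 s \<Longrightarrow> norm (h \<zeta>) \<le> B"
  shows "norm (deriv h 0) \<le> B / s"
proof -
  have B0: "0 \<le> B" using B[of 0] s by (smt (verit) centre_in_ball norm_ge_zero)
  have "norm (deriv h 0) * t \<le> B" if t: "0 < t" "t < s" for t
  proof -
    have "norm ((deriv ^^ 1) h 0) \<le> fact 1 * B / t ^ 1"
    proof (rule Cauchy_inequality)
      show "h holomorphic_on ball 0 t" using h by (rule holomorphic_on_subset) (use t in auto)
      show "continuous_on (cball 0 t) h"
        using holomorphic_on_imp_continuous_on[OF h] by (rule continuous_on_subset) (use t in auto)
    qed (use t B in auto)
    then show ?thesis using t by (simp add: field_simps)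
  qed
  then have "norm (deriv h 0) * s \<le> B"
  proof -
    assume le: "\<And>t. 0 < t \<Longrightarrow> t < s \<Longrightarrow> norm (deriv h 0) * t \<le> B"
    have "norm (deriv h 0) * s \<le> B + e" if e: "0 < e" for e
    proof -
      define D where "D = norm (deriv h 0)"
      \<comment> \<open>Within e / (D + 1) of \<open>s\<close>, so that D (s - t) <= e; the value s
        / 2 keeps \<open>t\<close> positive.\<close>
      define t where "t = max (s / 2) (s - e / (D + 1))"
      have D: "0 \<le> D" by (simp add: D_def)
      have "0 < e / (D + 1)" using e D by simp
      then have t: "0 < t" "t < s" using s by (auto simp: t_def)
      have "D * s \<le> D * (t + e / (D + 1))" using D by (intro mult_left_mono) (auto simp: t_def)
      also have "\<dots> = D * t + D * (e / (D + 1))" by (simp add: distrib_left)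
      also have "D * t \<le> B" using le[OF t] by (simp add: D_def)
      also have "D * (e / (D + 1)) \<le> e" using e D by (simp add: field_simps)
      finally show ?thesis by (simp add: D_def)
    qed
    then show ?thesis by (rule field_le_epsilon)
  qed
  then show ?thesis using s by (simp add: field_simps)
qed

lemma one_minus_cnj_mult: "1 - cnj c * c = of_real (1 - (norm c)\<^sup>2)"
  by (simp add: complex_norm_square[symmetric] mult.commute)

text \<open>Composing with the disc automorphism that moves h 0 to 0, whose derivative at h 0 is 1 /
  (1 - |h 0|^2), reduces the claim to Cauchy's inequality with bound 1.\<close>

lemma schwarz_pick_origin:
  assumes h: "h holomorphic_on ball 0 1" and le: "\<And>\<zeta>. \<zeta> \<in> ball 0 1 \<Longrightarrow> norm (h \<zeta>) < 1"
  shows "norm (deriv h 0) \<le> 1 - (norm (h 0))\<^sup>2"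
proof -
  define c where "c = h 0"
  let ?M = "Moebius_function 0 c"
  have c: "norm c < 1" unfolding c_def by (rule le) simp
  note n1 = one_minus_cnj_mult[of c]
  have pos: "0 < 1 - (norm c)\<^sup>2" using c by (simp add: power_less_one_iff abs_square_less_1)
  have nz: "1 - cnj c * c \<noteq> 0" unfolding n1 using pos by (simp only: of_real_eq_0_iff)
  have "(?M has_field_derivative
      (1 * (1 - cnj c * c) - (c - c) * (- cnj c)) / ((1 - cnj c * c) * (1 - cnj c * c))) (at c)"
    unfolding Moebius_function_simple
    by (rule DERIV_divide) (use nz in \<open>auto intro!: derivative_eq_intros\<close>)
  then have dM: "(?M has_field_derivative 1 / (1 - cnj c * c)) (at c)" using nz by simp
  have dh: "(h has_field_derivative deriv h 0) (at 0)"
    using h by (rule holomorphic_derivI) auto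
  have "((\<lambda>\<zeta>. ?M (h \<zeta>)) has_field_derivative 1 / (1 - cnj c * c) * deriv h 0) (at 0)"
    using dM dh unfolding c_def by (rule DERIV_chain2)
  then have d: "deriv (\<lambda>\<zeta>. ?M (h \<zeta>)) 0 = deriv h 0 / of_real (1 - (norm c)\<^sup>2)"
    by (simp add: DERIV_imp_deriv n1)
  have "(?M \<circ> h) holomorphic_on ball 0 1"
    using h Moebius_function_holomorphic[OF c, of 0]
    by (rule holomorphic_on_compose_gen) (use le in auto)
  then have "norm (deriv (\<lambda>\<zeta>. ?M (h \<zeta>)) 0) \<le> 1 / 1"
    using le c by (intro cauchy_deriv_bound) (auto simp: o_def intro!: less_imp_le Moebius_function_norm_lt_1)
  then show ?thesis unfolding d using pos by (simp add: norm_divide c_def del: of_real_diff)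
qed

section \<open>Characters, analytic discs and point derivations\<close>

context weight
begin

text \<open>Makes evaluation at \<open>z\<close> a functional of norm at most 1 with respect to
  \<open>N \<rho>\<close>.\<close>

definition dominated :: "(nat \<Rightarrow> complex) \<Rightarrow> real \<Rightarrow> bool" where
  "dominated z \<rho> \<longleftrightarrow> (\<forall>k\<in>MI n. norm (mev n z k) \<le> w \<rho> k)"

lemma ev_summable:
  assumes "f \<in> A" "dominated z \<rho>" "0 < \<rho>" "\<rho> < r"
  shows "(\<lambda>k. norm (f k * mev n z k)) summable_on MI n"
  using A_summable[OF assms(1,3,4)]
proof (rule summable_on_comparison_test)
  fix k assume "k \<in> MI n"
  then show "norm (f k * mev n z k) \<le> norm (f k) * w \<rho> k"
    using assms(2) by (auto simp: dominated_def norm_mult intro: mult_left_mono)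
qed auto

lemma ev_has_sum:
  assumes "f \<in> A" "dominated z \<rho>" "0 < \<rho>" "\<rho> < r"
  shows "((\<lambda>k. f k * mev n z k) has_sum ev n z f) (MI n)"
  unfolding ev_def using abs_summable_summable[OF ev_summable[OF assms]] by simp

lemma ev_bound:
  assumes "f \<in> A" "dominated z \<rho>" "0 < \<rho>" "\<rho> < r"
  shows "norm (ev n z f) \<le> N \<rho> f"
proof -
  have "norm (ev n z f) \<le> (\<Sum>\<^sub>\<infinity>k\<in>MI n. norm (f k * mev n z k))"
    unfolding ev_def by (rule norm_infsum_bound[OF ev_summable[OF assms]])
  also have "\<dots> \<le> N \<rho> f"
    unfolding wnorm_def using assms
    by (intro infsum_mono ev_summable[OF assms] A_summable)
      (auto simp: dominated_def norm_mult intro: mult_left_mono)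
  finally show ?thesis .
qed

lemma ev_add:
  assumes "f \<in> A" "g \<in> A" "dominated z \<rho>" "0 < \<rho>" "\<rho> < r"
  shows "ev n z (\<lambda>k. f k + g k) = ev n z f + ev n z g"
proof -
  have "((\<lambda>k. f k * mev n z k + g k * mev n z k) has_sum (ev n z f + ev n z g)) (MI n)"
    using assms by (intro has_sum_add ev_has_sum)
  then show ?thesis unfolding ev_def[of n z "\<lambda>k. f k + g k"] by (simp add: infsumI distrib_right)
qed

lemma ev_scale: "ev n z (\<lambda>k. c * f k) = c * ev n z f"
  unfolding ev_def by (simp add: mult.assoc infsum_cmult_right')

lemma ev_mon:
  assumes "k \<in> MI n" shows "ev n z (mon k) = mev n z k"
proof -
  have "ev n z (mon k) = (\<Sum>\<^sub>\<infinity>j\<in>{k}. mon k j * mev n z j)"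
    unfolding ev_def by (rule infsum_cong_neutral) (use assms in \<open>auto simp: mon_def\<close>)
  then show ?thesis by simp
qed

lemma ev_bfun:
  assumes "dominated z \<rho>" "0 < \<rho>" "\<rho> < r" shows "bfun (ev n z)"
  using ev_bound[OF _ assms] ev_add[OF _ _ assms] assms
  by (intro bfunI[of _ \<rho> 1]) (auto simp: ev_scale)

text \<open>For q = 1 the product is a plain Cauchy product, and z^k z^l = z^m for every splitting m
  = k + l.\<close>

lemma ev_mult:
  assumes "f \<in> A" "g \<in> A" "dominated z \<rho>" "0 < \<rho>" "\<rho> < r"
  shows "ev n z (qmul 1 n f g) = ev n z f * ev n z g"
proof -
  have "((\<lambda>m. \<Sum>k\<in>le_idx n m. (f k * mev n z k) * (g (\<lambda>i. m i - k i) * mev n z (\<lambda>i. m i - k i)))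
      has_sum (ev n z f * ev n z g)) (MI n)"
    unfolding ev_def using assms by (intro cauchy_product_MI ev_summable)
  also have "?this \<longleftrightarrow> ((\<lambda>m. qmul 1 n f g m * mev n z m) has_sum (ev n z f * ev n z g)) (MI n)"
  proof (rule has_sum_cong)
    fix m assume m: "m \<in> MI n"
    have "(f k * mev n z k) * (g (\<lambda>i. m i - k i) * mev n z (\<lambda>i. m i - k i)) =
        f k * g (\<lambda>i. m i - k i) * mev n z m" if "k \<in> le_idx n m" for k
      using mev_add[of n z k "\<lambda>i. m i - k i"] le_idx_add[OF that] by simp
    note eq = this
    show "(\<Sum>k\<in>le_idx n m. (f k * mev n z k) * (g (\<lambda>i. m i - k i) * mev n z (\<lambda>i. m i - k i)))
        = qmul 1 n f g m * mev n z m"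
      using m by (simp add: qmul_altdef sum_distrib_right eq cong: sum.cong)
  qed
  finally show ?thesis unfolding ev_def[of n z "qmul 1 n f g"] by (rule infsumI)
qed

text \<open>On each smaller disc one radius \<rho> < r has to work for all points; this gives
  uniform convergence of the evaluated series there.\<close>

definition analytic_disc :: "(complex \<Rightarrow> nat \<Rightarrow> complex) \<Rightarrow> bool" where
  "analytic_disc d \<longleftrightarrow> (\<forall>i<n. (\<lambda>\<zeta>. d \<zeta> i) holomorphic_on ball 0 1) \<and>
     (\<forall>s<1. \<exists>\<rho>. 0 < \<rho> \<and> \<rho> < r \<and> (\<forall>\<zeta>\<in>ball 0 s. dominated (d \<zeta>) \<rho>))"

lemma analytic_disc_dominated:
  assumes "analytic_disc d" "\<zeta> \<in> ball 0 1"
  obtains \<rho> where "0 < \<rho>" "\<rho> < r" "dominated (d \<zeta>) \<rho>"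
proof -
  define s where "s = (norm \<zeta> + 1) / 2"
  have "s < 1" "\<zeta> \<in> ball 0 s" using assms(2) by (auto simp: s_def)
  then show ?thesis using assms(1) that unfolding analytic_disc_def by meson
qed

text \<open>Weierstrass M-test with majorant \<open>norm (f k) * w \<rho> k\<close>; the partial
  sums are polynomials in the holomorphic coordinates of the disc.\<close>

lemma ev_holomorphic:
  assumes d: "analytic_disc d" and f: "f \<in> A"
  shows "(\<lambda>\<zeta>. ev n (d \<zeta>) f) holomorphic_on ball 0 1"
proof (rule holomorphic_on_open[THEN iffD2], safe)
  fix \<zeta>0 :: complex assume \<zeta>0: "\<zeta>0 \<in> ball 0 1"
  define s where "s = (norm \<zeta>0 + 1) / 2"
  define e where "e = (s - norm \<zeta>0) / 2"
  have s: "s < 1" "0 < e" using \<zeta>0 by (auto simp: s_def e_def)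
  have sub: "cball \<zeta>0 e \<subseteq> ball 0 s"
  proof
    fix y assume "y \<in> cball \<zeta>0 e"
    then have "norm y \<le> norm \<zeta>0 + e" using norm_triangle_sub[of y \<zeta>0] by (simp add: dist_norm norm_minus_commute)
    also have "\<dots> < s" using s(2) by (simp add: e_def field_simps)
    finally show "y \<in> ball 0 s" by simp
  qed
  have sub1: "cball \<zeta>0 e \<subseteq> ball 0 1" using sub s by (auto intro: order.trans[OF _ ball_subset_ball_iff[THEN iffD2]])
  obtain \<rho> where \<rho>: "0 < \<rho>" "\<rho> < r" "\<And>\<zeta>. \<zeta> \<in> ball 0 s \<Longrightarrow> dominated (d \<zeta>) \<rho>"
    using d s unfolding analytic_disc_def by meson
  have "uniform_limit (cball \<zeta>0 e) (\<lambda>X \<zeta>. \<Sum>k\<in>X. f k * mev n (d \<zeta>) k) (\<lambda>\<zeta>. ev n (d \<zeta>) f)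
      (finite_subsets_at_top (MI n))"
    unfolding ev_def
  proof (rule Weierstrass_m_test_general[OF _ A_summable[OF f \<rho>(1,2)]])
    fix k \<zeta> assume "k \<in> MI n" "\<zeta> \<in> cball \<zeta>0 e"
    then have "norm (mev n (d \<zeta>) k) \<le> w \<rho> k"
      using \<rho>(3)[OF subsetD[OF sub]] by (auto simp: dominated_def)
    then show "norm (f k * mev n (d \<zeta>) k) \<le> norm (f k) * w \<rho> k"
      by (auto simp: norm_mult intro: mult_left_mono)
  qed
  moreover have hol: "(\<lambda>\<zeta>. \<Sum>k\<in>X. f k * mev n (d \<zeta>) k) holomorphic_on ball 0 1" for X
    using d unfolding mev_def analytic_disc_def by (intro holomorphic_intros) auto
  ultimately have "(\<lambda>\<zeta>. ev n (d \<zeta>) f) holomorphic_on ball \<zeta>0 e"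
  proof (elim holomorphic_uniform_limit[rotated])
    show "\<forall>\<^sub>F X in finite_subsets_at_top (MI n).
       continuous_on (cball \<zeta>0 e) (\<lambda>\<zeta>. \<Sum>k\<in>X. f k * mev n (d \<zeta>) k) \<and>
       (\<lambda>\<zeta>. \<Sum>k\<in>X. f k * mev n (d \<zeta>) k) holomorphic_on ball \<zeta>0 e"
      using sub1 ball_subset_cball[of \<zeta>0 e]
      by (intro always_eventually allI conjI continuous_on_subset[OF holomorphic_on_imp_continuous_on[OF hol]]
          holomorphic_on_subset[OF hol]) auto
  qed auto
  then show "\<exists>f'. ((\<lambda>\<zeta>. ev n (d \<zeta>) f) has_field_derivative f') (at \<zeta>0)"
    using s(2) by (meson centre_in_ball holomorphic_on_open open_ball)
qed auto

text \<open>The point derivation at \<open>d 0\<close> in the direction of the velocity of the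
  disc.\<close>

definition disc_deriv :: "(complex \<Rightarrow> nat \<Rightarrow> complex) \<Rightarrow> series \<Rightarrow> complex" where
  "disc_deriv d f = deriv (\<lambda>\<zeta>. ev n (d \<zeta>) f) 0"

lemma has_disc_deriv:
  assumes "analytic_disc d" "f \<in> A"
  shows "((\<lambda>\<zeta>. ev n (d \<zeta>) f) has_field_derivative disc_deriv d f) (at 0)"
  unfolding disc_deriv_def by (rule holomorphic_derivI[OF ev_holomorphic[OF assms]]) auto

lemma disc_deriv_eqI:
  assumes "\<And>\<zeta>. \<zeta> \<in> ball 0 1 \<Longrightarrow> ev n (d \<zeta>) f = g \<zeta>" "(g has_field_derivative D) (at 0)"
  shows "disc_deriv d f = D"
proof -
  have "((\<lambda>\<zeta>. ev n (d \<zeta>) f) has_field_derivative D) (at 0)"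
    by (rule has_field_derivative_transform_within_open[OF assms(2), of "ball 0 1"]) (use assms(1) in auto)
  then show ?thesis unfolding disc_deriv_def by (rule DERIV_imp_deriv)
qed

text \<open>Cauchy's inequality on the disc of radius 1/2, where one norm bounds all
  evaluations.\<close>

lemma disc_deriv_bfun:
  assumes d: "analytic_disc d" shows "bfun (disc_deriv d)"
proof -
  obtain \<rho> where \<rho>: "0 < \<rho>" "\<rho> < r" "\<And>\<zeta>. \<zeta> \<in> ball 0 (1/2) \<Longrightarrow> dominated (d \<zeta>) \<rho>"
    using d unfolding analytic_disc_def by (metis half_gt_zero_iff less_numeral_extra(1) field_sum_of_halves less_add_same_cancel2)
  show ?thesis
  proof (rule bfunI[OF _ _ \<rho>(1,2)])
    fix f assume f: "f \<in> A"
    have "norm (disc_deriv d f) \<le> N \<rho> f / (1/2)"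
      unfolding disc_deriv_def
    proof (rule cauchy_deriv_bound)
      show "(\<lambda>\<zeta>. ev n (d \<zeta>) f) holomorphic_on ball 0 (1/2)"
        using ev_holomorphic[OF d f] by (rule holomorphic_on_subset) auto
      show "norm (ev n (d \<zeta>) f) \<le> N \<rho> f" if "\<zeta> \<in> ball 0 (1/2)" for \<zeta>
        using ev_bound[OF f \<rho>(3)[OF that] \<rho>(1,2)] .
    qed auto
    then show "norm (disc_deriv d f) \<le> 2 * N \<rho> f" by simp
    show "disc_deriv d (\<lambda>k. c * f k) = c * disc_deriv d f" for c
      by (rule disc_deriv_eqI[where g = "\<lambda>\<zeta>. c * ev n (d \<zeta>) f"])
        (auto simp: ev_scale intro: DERIV_cmult has_disc_deriv[OF d f])
    fix g assume g: "g \<in> A"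
    show "disc_deriv d (\<lambda>k. f k + g k) = disc_deriv d f + disc_deriv d g"
    proof (rule disc_deriv_eqI)
      fix \<zeta> :: complex assume "\<zeta> \<in> ball 0 1"
      then obtain \<rho> where "0 < \<rho>" "\<rho> < r" "dominated (d \<zeta>) \<rho>" using analytic_disc_dominated[OF d] by blast
      then show "ev n (d \<zeta>) (\<lambda>k. f k + g k) = ev n (d \<zeta>) f + ev n (d \<zeta>) g" using ev_add f g by blast
    qed (intro DERIV_add has_disc_deriv d f g)
  qed
qed

lemma disc_deriv_mult:
  assumes d: "analytic_disc d" and f: "f \<in> A" and g: "g \<in> A"
  shows "disc_deriv d (qmul 1 n f g) = ev n (d 0) f * disc_deriv d g + disc_deriv d f * ev n (d 0) g"
proof (rule disc_deriv_eqI)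
  fix \<zeta> :: complex assume "\<zeta> \<in> ball 0 1"
  then obtain \<rho> where "0 < \<rho>" "\<rho> < r" "dominated (d \<zeta>) \<rho>" using analytic_disc_dominated[OF d] by blast
  then show "ev n (d \<zeta>) (qmul 1 n f g) = ev n (d \<zeta>) f * ev n (d \<zeta>) g" using ev_mult f g by blast
next
  show "((\<lambda>\<zeta>. ev n (d \<zeta>) f * ev n (d \<zeta>) g) has_field_derivative
      ev n (d 0) f * disc_deriv d g + disc_deriv d f * ev n (d 0) g) (at 0)"
    using DERIV_mult'[OF has_disc_deriv[OF d f] has_disc_deriv[OF d g]] .
qed

lemma disc_deriv_gen:
  assumes "analytic_disc d" "i < n" "((\<lambda>\<zeta>. d \<zeta> i) has_field_derivative D) (at 0)"
  shows "disc_deriv d (gen i) = D"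
  using assms(3) by (rule disc_deriv_eqI[rotated]) (use assms(2) in \<open>simp add: ev_mon\<close>)

lemma disc_deriv_one:
  assumes "analytic_disc d" shows "disc_deriv d (mon zidx) = 0"
  by (rule disc_deriv_eqI[where g = "\<lambda>_. 1"]) (auto simp: ev_mon)

text \<open>A point derivation at the origin is a combination of first-order coefficients, because
  both sides agree at 1 and on every product x_i x^k.\<close>

lemma derivation_at_zero:
  assumes T: "bfun T" and one: "T (mon zidx) = 0" and f: "f \<in> A"
    and deriv: "\<And>i k. i < n \<Longrightarrow> k \<in> MI n \<Longrightarrow> T (qmul 1 n (gen i) (mon k)) = T (gen i) * mon k zidx"
  shows "T f = (\<Sum>l<n. T (gen l) * f (unit_idx l))"
proof -
  let ?L = "\<lambda>f. \<Sum>l<n. T (gen l) * f (unit_idx l)"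
  have "bfun (\<lambda>f. T f - ?L f)" by (intro bfun_diff T bfun_lincomb bfun_coeff) auto
  then have "T f - ?L f = 0"
  proof (rule bfun_vanish_gen[where q = 1])
    fix i k assume ik: "i < n" "k \<in> MI n"
    have "?L (qmul 1 n (gen i) (mon k)) = (\<Sum>l<n. if l = i then T (gen i) * mon k zidx else 0)"
      by (rule sum.cong) (auto simp: qmul_unit_coeff)
    then show "T (qmul 1 n (gen i) (mon k)) - ?L (qmul 1 n (gen i) (mon k)) = 0"
      using ik by (simp add: deriv)
  qed (use one f in auto)
  then show ?thesis by simp
qed

end

context hom
begin

text \<open>Evaluation at \<open>z\<close> after \<phi> is again multiplicative, so on monomials it
  is evaluation at the image of \<open>z\<close> under the holomorphic map dual to \<phi>.\<close>

lemma ev_hom_mon: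
  assumes q: "q = 1" and z: "T.dominated z \<rho>" "0 < \<rho>" "\<rho> < r" and k: "k \<in> MI n"
  shows "ev n z (\<phi> (mon k)) = mev n (\<lambda>i. ev n z (\<phi> (gen i))) k"
  using k
proof (induction rule: MI_induct)
  case zero
  then show ?case by (simp add: one T.ev_mon)
next
  case (step i k)
  have "\<phi> (mon (addi (unit_idx i) k)) = qmul 1 n (\<phi> (gen i)) (\<phi> (mon k))"
    using mon_add[of "unit_idx i" k] step q by simp
  then show ?case
    using step T.ev_mult[OF maps maps z, of "gen i" "mon k"] by (simp add: mev_add)
qed

text \<open>Continuity of that character bounds all monomials at the image point by a weight of
  radius \<sigma> < r; this locates the point in the polydisc or the ball.\<close>

lemma ev_hom_bound:
  assumes q: "q = 1" and z: "T.dominated z \<rho>" "0 < \<rho>" "\<rho> < r"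
  obtains C \<sigma> where "0 < \<sigma>" "\<sigma> < r"
    "\<And>k. k \<in> MI n \<Longrightarrow> norm (mev n (\<lambda>i. ev n z (\<phi> (gen i))) k) \<le> C * w \<sigma> k"
proof -
  have "S.bfun (\<lambda>f. ev n z (\<phi> f))" by (rule bfun_comp[OF T.ev_bfun[OF z]])
  then obtain C \<sigma> where C: "0 \<le> C" "0 < \<sigma>" "\<sigma> < r" "\<And>f. f \<in> S.A \<Longrightarrow> norm (ev n z (\<phi> f)) \<le> C * S.N \<sigma> f"
    by (rule S.bfun_bound) blast
  have "norm (mev n (\<lambda>i. ev n z (\<phi> (gen i))) k) \<le> C * w \<sigma> k" if "k \<in> MI n" for k
    using C(4)[of "mon k"] that ev_hom_mon[OF q z that] S.N_mon[OF that] by simp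
  then show ?thesis using that C(2,3) by blast
qed

end

text \<open>G 0 need not be the centre of the polydisc. The resulting factors 1 - |\<gamma> i|^2
  occur both in the velocities of the discs and in the Schwarz-Pick bounds for G, so that they
  cancel.\<close>

lemma no_iso_trivial_q:
  assumes "hom_iso n (wD n) (wB n) r 1 \<phi> \<psi>"
  shows False
proof -
  interpret hom_iso n "wD n" "wB n" r 1 \<phi> \<psi> by fact
  have r: "0 < r" by (rule F.S.r_pos)
  have n: "0 < n" "1 < n" using two_le by auto

  have domB: "F.T.dominated z \<rho>" if "0 \<le> \<rho>" "(\<Sum>i<n. (norm (z i))\<^sup>2) \<le> \<rho>\<^sup>2" for z \<rho>
    unfolding F.T.dominated_def using that mev_le_wB by blast
  have domD: "F.S.dominated z \<rho>" if "\<And>i. i < n \<Longrightarrow> norm (z i) \<le> \<rho>" for z \<rho>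
    unfolding F.S.dominated_def using that mev_le_wD by blast

  \<comment> \<open>The bounds for the powers x_i^m alone confine the i-th coordinate to radius
    \<sigma> < r.\<close>
  have G_in_D: "norm (ev n z (\<phi> (gen i))) < r"
    if z: "F.T.dominated z \<rho>" "0 < \<rho>" "\<rho> < r" and i: "i < n" for z \<rho> i
  proof -
    obtain C \<sigma> where C: "0 < \<sigma>" "\<sigma> < r"
      "\<And>k. k \<in> MI n \<Longrightarrow> norm (mev n (\<lambda>i. ev n z (\<phi> (gen i))) k) \<le> C * wD n \<sigma> k"
      using F.ev_hom_bound[OF refl z] by blast
    have "norm (ev n z (\<phi> (gen i))) \<le> \<sigma>"
    proof (rule exp_growth_le[of _ _ C 0])
      fix m
      have "(\<lambda>j. m * unit_idx i j) \<in> MI n" using unit_idx_MI[OF i] by (simp add: MI_def)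
      from C(3)[OF this] show "norm (ev n z (\<phi> (gen i))) ^ m \<le> C * (real m + 1) ^ 0 * \<sigma> ^ m"
        using i by (simp add: mev_unit_multiple wD_unit_multiple norm_power)
    qed (use C in auto)
    then show ?thesis using C(2) by simp
  qed

  have F_in_B: "(\<Sum>l<n. (norm (ev n z (\<psi> (gen l))))\<^sup>2) \<le> r\<^sup>2"
    if z: "F.S.dominated z \<rho>" "0 < \<rho>" "\<rho> < r" for z \<rho>
  proof -
    obtain C \<sigma> where C: "0 < \<sigma>" "\<sigma> < r"
      "\<And>k. k \<in> MI n \<Longrightarrow> norm (mev n (\<lambda>i. ev n z (\<psi> (gen i))) k) \<le> C * wB n \<sigma> k"
      using G.ev_hom_bound[OF refl z] by blast
    have "(\<Sum>l<n. (norm (ev n z (\<psi> (gen l))))\<^sup>2) \<le> \<sigma>\<^sup>2"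
      using C by (intro sum_squares_le_of_wB_bound)
    also have "\<dots> \<le> r\<^sup>2" using C by (intro power_mono) auto
    finally show ?thesis .
  qed

  \<comment> \<open>\<open>c\<close> is the point G 0 and \<gamma> its rescaling to the unit
    polydisc.\<close>
  define c where "c i = \<phi> (gen i) zidx" for i
  define \<gamma> where "\<gamma> i = c i / r" for i
  have ev0: "ev n (\<lambda>_. 0) f = f zidx" if "f \<in> F.T.A" for f
  proof -
    have z: "mev n (\<lambda>_. 0) k = (if k = zidx then 1 else 0)" if "k \<in> MI n" for k
    proof (cases "k = zidx")
      case False
      then have "deg n k \<noteq> 0" using deg_eq_0[OF that] by simp
      then obtain i where "i < n" "k i \<noteq> 0" by (auto simp: deg_def)
      then show ?thesis using False by (auto simp: mev_def)
    qed simp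
    have "ev n (\<lambda>_. 0) f = (\<Sum>\<^sub>\<infinity>k\<in>{zidx}. f k * mev n (\<lambda>_. 0) k)"
      unfolding ev_def by (rule infsum_cong_neutral) (auto simp: z)
    then show ?thesis by simp
  qed
  have half: "0 < r / 2" "r / 2 < r" using r by auto
  have c_lt: "norm (c i) < r" if "i < n" for i
  proof -
    have "F.T.dominated (\<lambda>_. 0) (r / 2)" using r by (intro domB) auto
    from G_in_D[OF this half that] show ?thesis
      using that by (simp add: ev0[OF F.maps] c_def)
  qed
  have \<gamma>_lt: "norm (\<gamma> i) < 1" if "i < n" for i
    using c_lt[OF that] r by (simp add: \<gamma>_def norm_divide)
  have \<gamma>_pos: "0 < 1 - (norm (\<gamma> i))\<^sup>2" if "i < n" for i
    using \<gamma>_lt[OF that] by (simp add: abs_square_less_1)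

  \<comment> \<open>Schwarz-Pick for the coordinates of \<open>G\<close> along the line through 0 with direction \<open>u\<close>.\<close>
  have sp: "r\<^sup>2 \<le> (\<Sum>l<n. (norm (u l))\<^sup>2)"
    if i: "i < n" and u: "norm (\<Sum>l<n. \<phi> (gen i) (unit_idx l) * u l) = r * (1 - (norm (\<gamma> i))\<^sup>2)" for i u
  proof (rule ccontr)
    assume lt: "\<not> ?thesis"
    define x where "x = sqrt (\<Sum>l<n. (norm (u l))\<^sup>2)"
    have x2: "x\<^sup>2 = (\<Sum>l<n. (norm (u l))\<^sup>2)" and x0: "0 \<le> x" by (simp_all add: x_def sum_nonneg)
    have xr: "x < r" using lt r by (intro power2_less_imp_less[of x r]) (auto simp: x2)
    \<comment> \<open>A stretching factor with S > 1 and still S x < r: the stretched line over the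
      unit disc stays in a ball of radius \<rho> < r, and its derivative exceeds the Schwarz-Pick
      bound by the factor \<open>S\<close>.\<close>
    define S where "S = 2 * r / (x + r)"
    define \<rho> where "\<rho> = (S * x + r) / 2"
    have S: "1 < S" using xr x0 r by (simp add: S_def field_simps)
    have "S * x = r * (2 * x / (x + r))" by (simp add: S_def)
    also have "\<dots> < r * 1" using xr x0 r by (intro mult_strict_left_mono) (auto simp: field_simps)
    finally have Sx: "S * x < r" by simp
    have \<rho>: "0 < \<rho>" "\<rho> < r" "S * x \<le> \<rho>" using Sx r x0 S by (auto simp: \<rho>_def add_nonneg_pos)
    define d where "d = (\<lambda>\<zeta> l. \<zeta> * (of_real S * u l))"
    have dom: "F.T.dominated (d \<zeta>) \<rho>" if "\<zeta> \<in> ball 0 1" for \<zeta>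
    proof (rule domB)
      have "(\<Sum>l<n. (norm (d \<zeta> l))\<^sup>2) = (norm \<zeta> * (S * x))\<^sup>2"
        using S by (simp add: d_def norm_mult power_mult_distrib x2 mult.assoc sum_distrib_left)
      also have "\<dots> \<le> \<rho>\<^sup>2"
      proof (intro power_mono)
        have "norm \<zeta> * (S * x) \<le> 1 * (S * x)" using that S x0 by (intro mult_right_mono) auto
        then show "norm \<zeta> * (S * x) \<le> \<rho>" using \<rho> by simp
      qed (use S x0 in auto)
      finally show "(\<Sum>l<n. (norm (d \<zeta> l))\<^sup>2) \<le> \<rho>\<^sup>2" .
    qed (use \<rho> in simp)
    have disc: "F.T.analytic_disc d"
      unfolding F.T.analytic_disc_def
    proof (intro conjI allI impI)
      show "(\<lambda>\<zeta>. d \<zeta> i) holomorphic_on ball 0 1" for i unfolding d_def by (intro holomorphic_intros)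
      show "\<exists>\<rho>. 0 < \<rho> \<and> \<rho> < r \<and> (\<forall>\<zeta>\<in>ball 0 s. F.T.dominated (d \<zeta>) \<rho>)" if "s < 1" for s
        using \<rho> dom that by (intro exI[of _ \<rho>]) auto
    qed
    have d0: "d 0 = (\<lambda>_. 0)" by (simp add: d_def)
    let ?T = "F.T.disc_deriv d"
    have gA: "\<phi> (gen i) \<in> F.T.A" using i by (intro F.maps) simp
    have T_gen: "?T (gen l) = of_real S * u l" if "l < n" for l
      by (rule F.T.disc_deriv_gen[OF disc that]) (auto simp: d_def intro!: derivative_eq_intros)
    have "?T (\<phi> (gen i)) = (\<Sum>l<n. ?T (gen l) * \<phi> (gen i) (unit_idx l))"
    proof (rule F.T.derivation_at_zero[OF F.T.disc_deriv_bfun[OF disc] F.T.disc_deriv_one[OF disc] gA])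
      fix j k assume "j < n" "k \<in> MI n"
      then show "?T (qmul 1 n (gen j) (mon k)) = ?T (gen j) * mon k zidx"
        by (simp add: F.T.disc_deriv_mult[OF disc] d0 ev0)
    qed
    also have "\<dots> = of_real S * (\<Sum>l<n. \<phi> (gen i) (unit_idx l) * u l)"
      unfolding sum_distrib_left by (rule sum.cong) (auto simp: T_gen)
    finally have nT: "norm (?T (\<phi> (gen i))) = S * (r * (1 - (norm (\<gamma> i))\<^sup>2))"
      using S u by (simp add: norm_mult)
    define h where "h = (\<lambda>\<zeta>. ev n (d \<zeta>) (\<phi> (gen i)) / r)"
    have "norm (deriv h 0) \<le> 1 - (norm (h 0))\<^sup>2"
    proof (rule schwarz_pick_origin)
      show "h holomorphic_on ball 0 1"
        unfolding h_def using r by (intro holomorphic_intros F.T.ev_holomorphic[OF disc gA]) auto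
      show "norm (h \<zeta>) < 1" if "\<zeta> \<in> ball 0 1" for \<zeta>
        using G_in_D[OF dom[OF that] \<rho>(1,2) i] r by (simp add: h_def norm_divide)
    qed
    moreover have "h 0 = \<gamma> i" using gA by (simp add: h_def d0 ev0 \<gamma>_def c_def)
    moreover have "deriv h 0 = ?T (\<phi> (gen i)) / r"
      unfolding h_def by (intro DERIV_imp_deriv DERIV_cdivide F.T.has_disc_deriv[OF disc gA])
    ultimately have "S * (1 - (norm (\<gamma> i))\<^sup>2) \<le> 1 * (1 - (norm (\<gamma> i))\<^sup>2)"
      using nT r by (simp add: norm_divide)
    then show False using S \<gamma>_pos[OF i] by (simp add: mult_le_cancel_right)
  qed

  \<comment> \<open>\<open>v\<close> is the velocity at 0 of the image under F of a disc through G
    0, and \<epsilon> is the sign of the second coordinate of that disc's velocity. The two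
    equations say that the differential of G at 0 takes \<open>v\<close> back to the first two
    coordinates of this velocity.\<close>
  have discs: "\<exists>v. (\<Sum>l<n. (norm (v l))\<^sup>2) \<le> r\<^sup>2 \<and>
      (\<Sum>l<n. \<phi> (gen 0) (unit_idx l) * v l) = of_real (r * (1 - (norm (\<gamma> 0))\<^sup>2)) \<and>
      (\<Sum>l<n. \<phi> (gen 1) (unit_idx l) * v l) = of_real \<epsilon> * of_real (r * (1 - (norm (\<gamma> 1))\<^sup>2))"
    if \<epsilon>: "\<bar>\<epsilon>\<bar> = 1" for \<epsilon> :: real
  proof -
    \<comment> \<open>A disc automorphism taking 0 to \<gamma> i, scaled by r; its derivative r (1 -
      |\<gamma> i|^2) at 0 is the maximum allowed by Schwarz-Pick.\<close>
    define M where "M i \<zeta> = of_real r * Moebius_function 0 (- \<gamma> i) \<zeta>" for i \<zeta>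
    have M_hol: "M i holomorphic_on ball 0 1" if "i < n" for i
      unfolding M_def using \<gamma>_lt[OF that] by (intro holomorphic_intros Moebius_function_holomorphic) auto
    have M_lt: "norm (M i \<zeta>) < r" if "i < n" "\<zeta> \<in> ball 0 1" for i \<zeta>
      using Moebius_function_norm_lt_1[of "- \<gamma> i" \<zeta> 0] \<gamma>_lt that r by (simp add: M_def norm_mult)
    have M0: "M i 0 = c i" for i using r by (simp add: M_def Moebius_function_simple \<gamma>_def)
    have M_deriv: "(M i has_field_derivative of_real (r * (1 - (norm (\<gamma> i))\<^sup>2))) (at 0)" for i
    proof -
      have "(M i has_field_derivative of_real r * (1 - cnj (\<gamma> i) * \<gamma> i)) (at 0)"
        unfolding M_def Moebius_function_simple by (auto intro!: derivative_eq_intros simp: algebra_simps)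
      then show ?thesis unfolding one_minus_cnj_mult by simp
    qed
    \<comment> \<open>Only the first two coordinates move. The sign is a reparametrisation of the
      second one, so its values stay in the disc of radius r.\<close>
    define d where "d = (\<lambda>\<zeta> i. if i = 0 then M 0 \<zeta> else if i = 1 then M 1 (of_real \<epsilon> * \<zeta>) else c i)"
    have norm_\<epsilon>: "norm (complex_of_real \<epsilon> * \<zeta>) = norm \<zeta>" for \<zeta> using \<epsilon> by (simp add: norm_mult)
    have d_hol: "(\<lambda>\<zeta>. d \<zeta> i) holomorphic_on ball 0 1" if "i < n" for i
    proof -
      have "(\<lambda>\<zeta>. M 1 (of_real \<epsilon> * \<zeta>)) holomorphic_on ball 0 1"
      proof (rule holomorphic_on_compose_gen[OF _ M_hol[OF n(2)], unfolded o_def])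
        show "(\<lambda>\<zeta>. complex_of_real \<epsilon> * \<zeta>) holomorphic_on ball 0 1" by (intro holomorphic_intros)
        show "(\<lambda>\<zeta>. complex_of_real \<epsilon> * \<zeta>) ` ball 0 1 \<subseteq> ball 0 1"
          using norm_\<epsilon> by (simp add: image_subset_iff)
      qed
      then show ?thesis unfolding d_def using M_hol[OF n(1)]
        by (cases "i = 0"; cases "i = 1") simp_all
    qed
    have d_lt: "norm (d \<zeta> i) < r" if "i < n" "\<zeta> \<in> ball 0 1" for \<zeta> i
      unfolding d_def using M_lt n c_lt that norm_\<epsilon>[of \<zeta>] by auto
    have disc: "F.S.analytic_disc d"
      unfolding F.S.analytic_disc_def
    proof (intro conjI allI impI)
      show "(\<lambda>\<zeta>. d \<zeta> i) holomorphic_on ball 0 1" if "i < n" for i using d_hol[OF that] .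
      fix s :: real assume s: "s < 1"
      \<comment> \<open>The maximum with 0 keeps the compact disc nonempty for negative
        \<open>s\<close>, so that each coordinate attains its maximal modulus, which is below
        r.\<close>
      let ?K = "cball (0 :: complex) (max s 0)"
      have K: "?K \<subseteq> ball 0 1" using s by auto
      have "\<exists>b<r. \<forall>\<zeta>\<in>?K. norm (d \<zeta> i) \<le> b" if i: "i < n" for i
      proof -
        have "continuous_on ?K (\<lambda>\<zeta>. norm (d \<zeta> i))"
          using continuous_on_subset[OF holomorphic_on_imp_continuous_on[OF d_hol[OF i]] K]
          by (rule continuous_on_norm)
        then obtain \<xi> where "\<xi> \<in> ?K" "\<forall>\<zeta>\<in>?K. norm (d \<zeta> i) \<le> norm (d \<xi> i)"
          using continuous_attains_sup[of ?K "\<lambda>\<zeta>. norm (d \<zeta> i)"] by auto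
        moreover from this have "norm (d \<xi> i) < r" using d_lt[OF i] K by blast
        ultimately show ?thesis by blast
      qed
      then obtain b where b: "\<And>i. i < n \<Longrightarrow> b i < r" "\<And>i \<zeta>. i < n \<Longrightarrow> \<zeta> \<in> ?K \<Longrightarrow> norm (d \<zeta> i) \<le> b i"
        by metis
      define \<rho> where "\<rho> = Max (insert (r / 2) (b ` {..<n}))"
      have "\<rho> \<in> insert (r / 2) (b ` {..<n})" unfolding \<rho>_def by (intro Max_in) auto
      then have "\<rho> < r" using b r by auto
      moreover have "r / 2 \<le> \<rho>" unfolding \<rho>_def by (intro Max_ge) auto
      then have "0 < \<rho>" using r by simp
      moreover have "F.S.dominated (d \<zeta>) \<rho>" if "\<zeta> \<in> ball 0 s" for \<zeta>
      proof (rule domD)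
        fix i assume i: "i < n"
        have "norm (d \<zeta> i) \<le> b i" using b(2)[OF i, of \<zeta>] that by auto
        also have "\<dots> \<le> \<rho>" unfolding \<rho>_def using i by (intro Max_ge) auto
        finally show "norm (d \<zeta> i) \<le> \<rho>" .
      qed
      ultimately show "\<exists>\<rho>. 0 < \<rho> \<and> \<rho> < r \<and> (\<forall>\<zeta>\<in>ball 0 s. F.S.dominated (d \<zeta>) \<rho>)" by blast
    qed
    have d0: "d 0 = c" by (auto simp: d_def M0 fun_eq_iff)
    let ?T = "F.S.disc_deriv d"
    define v where "v l = ?T (\<psi> (gen l))" for l
    have bf: "F.T.bfun (\<lambda>g. ?T (\<psi> g))" by (rule G.bfun_comp[OF F.S.disc_deriv_bfun[OF disc]])

    \<comment> \<open>\<open>F c = 0\<close>, in terms of characters\<close>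
    have ev_c: "ev n c g = \<phi> g zidx" if "g \<in> F.S.A" for g
    proof -
      have dom0: "F.T.dominated (\<lambda>_. 0) (r / 2)" using r by (intro domB) auto
      obtain \<rho> where \<rho>: "0 < \<rho>" "\<rho> < r" "F.S.dominated c \<rho>"
        using F.S.analytic_disc_dominated[OF disc, of 0] d0 by auto
      have "F.S.bfun (\<lambda>g. ev n c g - \<phi> g zidx)"
        by (intro F.S.bfun_diff F.bfun_comp F.T.bfun_coeff F.S.ev_bfun[OF \<rho>(3,1,2)]) auto
      then have "ev n c g - \<phi> g zidx = 0"
      proof (rule F.S.bfun_vanish[OF _ _ that])
        fix k assume k: "k \<in> MI n"
        have "\<phi> (mon k) zidx = mev n (\<lambda>i. ev n (\<lambda>_. 0) (\<phi> (gen i))) k"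
          using F.ev_hom_mon[OF refl dom0 half k] ev0[OF F.maps] k by simp
        also have "\<dots> = mev n c k"
          unfolding mev_def by (intro prod.cong) (auto simp: ev0[OF F.maps] c_def)
        finally show "ev n c (mon k) - \<phi> (mon k) zidx = 0" using k by (simp add: F.S.ev_mon)
      qed
      then show ?thesis by simp
    qed
    \<comment> \<open>The identity G (F z) = z differentiated at \<open>c\<close>: composed with
      \<psi>, the derivation along the disc becomes a point derivation at F c = 0, hence is
      determined by \<open>v\<close>.\<close>
    have push: "?T g = (\<Sum>l<n. \<phi> g (unit_idx l) * v l)" if g: "g \<in> F.S.A" for g
    proof -
      have "?T (\<psi> (\<phi> g)) = (\<Sum>l<n. ?T (\<psi> (gen l)) * \<phi> g (unit_idx l))"
      proof (rule F.T.derivation_at_zero[OF bf _ F.maps[OF g]])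
        show "?T (\<psi> (mon zidx)) = 0" by (simp add: G.one F.S.disc_deriv_one[OF disc])
        fix i k assume ik: "i < n" "k \<in> MI n"
        then show "?T (\<psi> (qmul 1 n (gen i) (mon k))) = ?T (\<psi> (gen i)) * mon k zidx"
          by (simp add: G.mult F.S.disc_deriv_mult[OF disc] G.maps d0 ev_c \<phi>\<psi>)
      qed
      then show ?thesis using g by (simp add: \<psi>\<phi> v_def mult.commute)
    qed
    have T0: "?T (gen 0) = of_real (r * (1 - (norm (\<gamma> 0))\<^sup>2))"
      using M_deriv by (intro F.S.disc_deriv_gen[OF disc n(1)]) (simp add: d_def)
    have T1: "?T (gen 1) = of_real \<epsilon> * of_real (r * (1 - (norm (\<gamma> 1))\<^sup>2))"
    proof (rule F.S.disc_deriv_gen[OF disc n(2)])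
      have "((\<lambda>\<zeta>. M 1 (of_real \<epsilon> * \<zeta>)) has_field_derivative
          of_real (r * (1 - (norm (\<gamma> 1))\<^sup>2)) * of_real \<epsilon>) (at 0)"
        using M_deriv[of 1] by (intro DERIV_chain2[of "M 1"]) (auto intro!: derivative_eq_intros)
      then show "((\<lambda>\<zeta>. d \<zeta> 1) has_field_derivative of_real \<epsilon> * of_real (r * (1 - (norm (\<gamma> 1))\<^sup>2))) (at 0)"
        by (simp add: d_def mult.commute)
    qed

    \<comment> \<open>Cauchy's inequality for the component of \<open>F\<close> in the direction of \<open>v\<close>.\<close>
    define h where "h = (\<lambda>\<zeta>. \<Sum>l<n. cnj (v l) * ev n (d \<zeta>) (\<psi> (gen l)))"
    define V where "V = (\<Sum>l<n. (norm (v l))\<^sup>2)"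
    have V0: "0 \<le> V" by (simp add: V_def sum_nonneg)
    have pA: "\<psi> (gen l) \<in> F.S.A" if "l < n" for l using that by (intro G.maps) simp
    have "(h has_field_derivative (\<Sum>l<n. cnj (v l) * v l)) (at 0)"
      unfolding h_def v_def
      by (intro DERIV_sum DERIV_cmult F.S.has_disc_deriv[OF disc pA]) auto
    moreover have "of_real V = (\<Sum>l<n. cnj (v l) * v l)"
      unfolding V_def of_real_sum complex_norm_square by (simp add: mult.commute)
    ultimately have dh: "deriv h 0 = of_real V" by (simp add: DERIV_imp_deriv)
    have "norm (deriv h 0) \<le> sqrt V * r / 1"
    proof (rule cauchy_deriv_bound)
      show "h holomorphic_on ball 0 1"
        unfolding h_def by (intro holomorphic_intros F.S.ev_holomorphic[OF disc pA]) auto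
      fix \<zeta> :: complex assume "\<zeta> \<in> ball 0 1"
      then obtain \<rho> where \<rho>: "0 < \<rho>" "\<rho> < r" "F.S.dominated (d \<zeta>) \<rho>"
        using F.S.analytic_disc_dominated[OF disc] by blast
      let ?e = "\<lambda>l. ev n (d \<zeta>) (\<psi> (gen l))"
      have "norm (h \<zeta>) \<le> (\<Sum>l<n. \<bar>norm (v l)\<bar> * \<bar>norm (?e l)\<bar>)"
        unfolding h_def by (rule sum_norm_le) (simp add: norm_mult)
      also have "\<dots> \<le> L2_set (\<lambda>l. norm (v l)) {..<n} * L2_set (\<lambda>l. norm (?e l)) {..<n}"
        by (rule L2_set_mult_ineq)
      also have "\<dots> \<le> sqrt V * r"
        unfolding L2_set_def V_def using F_in_B[OF \<rho>(3,1,2)] r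
        by (intro mult_left_mono real_le_lsqrt) (auto intro: sum_nonneg)
      finally show "norm (h \<zeta>) \<le> sqrt V * r" .
    qed auto
    \<comment> \<open>With V = |v|^2 this reads |v|^2 <= |v| r; cancelling |v| requires V = 0 to be
      treated apart.\<close>
    then have "V \<le> sqrt V * r" using V0 by (simp add: dh)
    then have VV: "sqrt V * sqrt V \<le> sqrt V * r" using V0 by simp
    have "sqrt V \<le> r"
    proof (cases "V = 0")
      case False
      then show ?thesis using VV V0 by (intro mult_left_le_imp_le[OF VV]) simp
    qed (use r in simp)
    then have "V \<le> r\<^sup>2" using V0 r by (simp add: sqrt_le_D)
    then show ?thesis
      using push[of "gen 0"] push[of "gen 1"] T0 T1 n by (intro exI[of _ v]) (simp add: V_def)
  qed

  obtain v where v: "(\<Sum>l<n. (norm (v l))\<^sup>2) \<le> r\<^sup>2"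
      "(\<Sum>l<n. \<phi> (gen 0) (unit_idx l) * v l) = of_real (r * (1 - (norm (\<gamma> 0))\<^sup>2))"
      "(\<Sum>l<n. \<phi> (gen 1) (unit_idx l) * v l) = of_real (r * (1 - (norm (\<gamma> 1))\<^sup>2))"
    using discs[of 1] by auto
  obtain u where u: "(\<Sum>l<n. (norm (u l))\<^sup>2) \<le> r\<^sup>2"
      "(\<Sum>l<n. \<phi> (gen 0) (unit_idx l) * u l) = of_real (r * (1 - (norm (\<gamma> 0))\<^sup>2))"
      "(\<Sum>l<n. \<phi> (gen 1) (unit_idx l) * u l) = - of_real (r * (1 - (norm (\<gamma> 1))\<^sup>2))"
    using discs[of "- 1"] by auto
  \<comment> \<open>Both discs have the same first velocity coordinate, so half the sum retains it
    and \<open>sp\<close> applies with index 0. Half the difference retains the second coordinate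
    and is treated with index 1.\<close>
  have "r\<^sup>2 \<le> (\<Sum>l<n. (norm ((v l + u l) / 2))\<^sup>2)"
  proof (rule sp[OF n(1)])
    have "(\<Sum>l<n. \<phi> (gen 0) (unit_idx l) * ((v l + u l) / 2)) =
        ((\<Sum>l<n. \<phi> (gen 0) (unit_idx l) * v l) + (\<Sum>l<n. \<phi> (gen 0) (unit_idx l) * u l)) / 2"
      by (simp add: distrib_left sum.distrib add_divide_distrib sum_divide_distrib)
    also have "\<dots> = of_real (r * (1 - (norm (\<gamma> 0))\<^sup>2))" unfolding v u by simp
    finally show "norm (\<Sum>l<n. \<phi> (gen 0) (unit_idx l) * ((v l + u l) / 2)) = r * (1 - (norm (\<gamma> 0))\<^sup>2)"
      using \<gamma>_pos[OF n(1)] r by (simp only: norm_of_real) simp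
  qed
  moreover have "r\<^sup>2 \<le> (\<Sum>l<n. (norm ((v l - u l) / 2))\<^sup>2)"
  proof (rule sp[OF n(2)])
    have "(\<Sum>l<n. \<phi> (gen 1) (unit_idx l) * ((v l - u l) / 2)) =
        ((\<Sum>l<n. \<phi> (gen 1) (unit_idx l) * v l) - (\<Sum>l<n. \<phi> (gen 1) (unit_idx l) * u l)) / 2"
      by (simp add: right_diff_distrib sum_subtractf diff_divide_distrib sum_divide_distrib)
    also have "\<dots> = of_real (r * (1 - (norm (\<gamma> 1))\<^sup>2))" unfolding v u by simp
    finally show "norm (\<Sum>l<n. \<phi> (gen 1) (unit_idx l) * ((v l - u l) / 2)) = r * (1 - (norm (\<gamma> 1))\<^sup>2)"
      using \<gamma>_pos[OF n(2)] r by (simp only: norm_of_real) simp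
  qed
  \<comment> \<open>The parallelogram law: the left side is at least 2 r^2, the right side at most
    r^2.\<close>
  moreover have "(\<Sum>l<n. (norm ((v l + u l) / 2))\<^sup>2) + (\<Sum>l<n. (norm ((v l - u l) / 2))\<^sup>2)
      = ((\<Sum>l<n. (norm (v l))\<^sup>2) + (\<Sum>l<n. (norm (u l))\<^sup>2)) / 2"
    unfolding sum.distrib[symmetric] sum_divide_distrib
  proof (intro sum.cong refl)
    fix l
    show "(norm ((v l + u l) / 2))\<^sup>2 + (norm ((v l - u l) / 2))\<^sup>2 = ((norm (v l))\<^sup>2 + (norm (u l))\<^sup>2) / 2"
      by (simp add: norm_divide power_divide cmod_power2) (simp add: field_simps power2_eq_square)
  qed
  ultimately have "2 * r\<^sup>2 \<le> r\<^sup>2" using u(1) v(1) by argo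
  then show False using r by simp
qed

section \<open>From topological isomorphisms to bounded unital homomorphisms\<close>

theorem theorem4p14:
  fixes q :: complex and n :: nat and r :: real
  assumes "norm q = 1" and "n \<ge> 2" and "r > 0"
  shows "\<not> (\<exists>\<phi>. bij_betw \<phi> (OqD n r) (OqB n r)
           \<and> (\<forall>f\<in>OqD n r. \<forall>g\<in>OqD n r. \<phi> (\<lambda>k. f k + g k) = (\<lambda>k. \<phi> f k + \<phi> g k))
           \<and> (\<forall>c::complex. \<forall>f\<in>OqD n r. \<phi> (\<lambda>k. c * f k) = (\<lambda>k. c * \<phi> f k))
           \<and> (\<forall>f\<in>OqD n r. \<forall>g\<in>OqD n r. \<phi> (qmul q n f g) = qmul q n (\<phi> f) (\<phi> g))
           \<and> continuous_map (topD n r) (topB n r) \<phi>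
           \<and> continuous_map (topB n r) (topD n r) (inv_into (OqD n r) \<phi>))"
proof
  assume "\<exists>\<phi>. bij_betw \<phi> (OqD n r) (OqB n r)
           \<and> (\<forall>f\<in>OqD n r. \<forall>g\<in>OqD n r. \<phi> (\<lambda>k. f k + g k) = (\<lambda>k. \<phi> f k + \<phi> g k))
           \<and> (\<forall>c::complex. \<forall>f\<in>OqD n r. \<phi> (\<lambda>k. c * f k) = (\<lambda>k. c * \<phi> f k))
           \<and> (\<forall>f\<in>OqD n r. \<forall>g\<in>OqD n r. \<phi> (qmul q n f g) = qmul q n (\<phi> f) (\<phi> g))
           \<and> continuous_map (topD n r) (topB n r) \<phi>
           \<and> continuous_map (topB n r) (topD n r) (inv_into (OqD n r) \<phi>)"
  then obtain \<phi> where bij: "bij_betw \<phi> (OqD n r) (OqB n r)"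
    and add: "\<forall>f\<in>OqD n r. \<forall>g\<in>OqD n r. \<phi> (\<lambda>k. f k + g k) = (\<lambda>k. \<phi> f k + \<phi> g k)"
    and scale: "\<forall>c::complex. \<forall>f\<in>OqD n r. \<phi> (\<lambda>k. c * f k) = (\<lambda>k. c * \<phi> f k)"
    and mult: "\<forall>f\<in>OqD n r. \<forall>g\<in>OqD n r. \<phi> (qmul q n f g) = qmul q n (\<phi> f) (\<phi> g)"
    and cont: "continuous_map (topD n r) (topB n r) \<phi>"
    and cont': "continuous_map (topB n r) (topD n r) (inv_into (OqD n r) \<phi>)"
    by (elim exE conjE)
  define \<psi> where "\<psi> = inv_into (OqD n r) \<phi>"
  interpret D: weight n "wD n" r by (rule weight_wD[OF assms(3)])
  interpret B: weight n "wB n" r by (rule weight_wB[OF assms(3)])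
  have \<phi>_maps: "\<phi> f \<in> OqB n r" if "f \<in> OqD n r" for f using bij that by (auto simp: bij_betw_def)
  have \<psi>_maps: "\<psi> g \<in> OqD n r" if "g \<in> OqB n r" for g
    using bij that unfolding \<psi>_def by (auto simp: bij_betw_def intro: inv_into_into)
  have \<psi>\<phi>: "\<psi> (\<phi> f) = f" if "f \<in> OqD n r" for f
    using bij that unfolding \<psi>_def by (simp add: bij_betw_inv_into_left)
  have \<phi>\<psi>: "\<phi> (\<psi> g) = g" if "g \<in> OqB n r" for g
    using bij that unfolding \<psi>_def by (simp add: bij_betw_inv_into_right)
  have one_in: "mon zidx \<in> OqD n r" "mon zidx \<in> OqB n r"
    unfolding OqD_def OqB_def by (simp_all)
  \<comment> \<open>Preservation of the unit comes from surjectivity: \<phi> 1 equals the product of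
    \<phi> 1 and \<phi> (\<psi> 1), which is \<phi> (\<psi> 1) = 1.\<close>
  have \<phi>_one: "\<phi> (mon zidx) = mon zidx"
  proof -
    have "\<phi> (mon zidx) = qmul q n (\<phi> (mon zidx)) (mon zidx)"
      using \<phi>_maps[OF one_in(1)] B.A_supp unfolding OqB_def by (simp add: qmul_one_right)
    also have "\<dots> = \<phi> (qmul q n (mon zidx) (\<psi> (mon zidx)))"
      using mult one_in \<psi>_maps \<phi>\<psi> by simp
    also have "\<dots> = \<phi> (\<psi> (mon zidx))"
      using \<psi>_maps[OF one_in(2)] D.A_supp unfolding OqD_def by (simp add: qmul_one_left)
    finally show ?thesis using \<phi>\<psi> one_in by simp
  qed
  have \<psi>_scale: "\<psi> (\<lambda>k. c * f k) = (\<lambda>k. c * \<psi> f k)" if "f \<in> OqB n r" for c f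
  proof -
    have "(\<lambda>k. c * \<psi> f k) \<in> OqD n r" using D.A_scale \<psi>_maps[OF that] by (simp add: OqD_def)
    then show ?thesis using \<psi>\<phi>[of "\<lambda>k. c * \<psi> f k"] scale \<psi>_maps[OF that] \<phi>\<psi>[OF that] by simp
  qed
  have \<psi>_add: "\<psi> (\<lambda>k. f k + g k) = (\<lambda>k. \<psi> f k + \<psi> g k)" if fg: "f \<in> OqB n r" "g \<in> OqB n r" for f g
  proof -
    have "(\<lambda>k. \<psi> f k + \<psi> g k) \<in> OqD n r"
      using D.A_add \<psi>_maps[OF fg(1)] \<psi>_maps[OF fg(2)] by (simp add: OqD_def)
    then show ?thesis using \<psi>\<phi>[of "\<lambda>k. \<psi> f k + \<psi> g k"] add \<psi>_maps fg \<phi>\<psi> by simp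
  qed
  \<comment> \<open>\<phi> maps the right side to the product of \<open>f\<close> and
    \<open>g\<close>; \<open>OqD_qmul\<close> puts that side into the domain of \<phi>, so applying
    \<psi> recovers it.\<close>
  have \<psi>_mult: "\<psi> (qmul q n f g) = qmul q n (\<psi> f) (\<psi> g)" if fg: "f \<in> OqB n r" "g \<in> OqB n r" for f g
    using \<psi>\<phi>[OF OqD_qmul[OF assms(3,1) \<psi>_maps[OF fg(1)] \<psi>_maps[OF fg(2)]]] mult \<psi>_maps fg \<phi>\<psi> by simp
  have "hom_iso n (wD n) (wB n) r q \<phi> \<psi>"
  proof (intro hom_iso.intro hom.intro hom_axioms.intro hom_iso_axioms.intro)
    show "\<exists>C \<sigma>. 0 \<le> C \<and> 0 < \<sigma> \<and> \<sigma> < r \<and> (\<forall>f\<in>D.A. B.N \<rho> (\<phi> f) \<le> C * D.N \<sigma> f)"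
      if "0 < \<rho>" "\<rho> < r" for \<rho>
      using cont scale that unfolding topD_def topB_def OqD_def OqB_def
      by (intro D.continuous_map_sn_top_bound B.weight_axioms) auto
    show "\<exists>C \<sigma>. 0 \<le> C \<and> 0 < \<sigma> \<and> \<sigma> < r \<and> (\<forall>f\<in>B.A. D.N \<rho> (\<psi> f) \<le> C * B.N \<sigma> f)"
      if "0 < \<rho>" "\<rho> < r" for \<rho>
      using cont'[folded \<psi>_def] \<psi>_scale that unfolding topD_def topB_def OqD_def OqB_def
      by (intro B.continuous_map_sn_top_bound D.weight_axioms) auto
    show "\<psi> (mon zidx) = mon zidx" using \<psi>\<phi>[OF one_in(1)] by (simp add: \<phi>_one)
  qed (use assms \<phi>_maps \<psi>_maps add scale mult \<psi>_add \<psi>_scale \<psi>_mult \<phi>_one \<psi>\<phi> \<phi>\<psi> in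
      \<open>simp_all add: OqD_def OqB_def D.weight_axioms B.weight_axioms\<close>)
  then show False using no_iso_trivial_q no_iso_nontrivial_q by (cases "q = 1") auto
qed

end
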